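(* Let $X$ be a scalar (real-valued) random variable with a probability density $p_X(\cdot)$ that is logarithmically concave. Then, given any probability value $\eta \in [0,1]$, one of the following holds: either (i) there is a unique interval $\mathscr{S}^* = [a^*_\eta,\, a^*_\eta + l^*_\eta]$ that has probability mass $\mathbb{P}[X\in\mathscr{S}^*]=\eta$ and that minimizes the conditional variance $$\mathbb{E}\left[\left(X - \mathbb{E}[X \mid X\in \mathscr{S}]\right)^2 \,\middle|\, X\in \mathscr{S}\right]$$ over all silence sets $\mathscr{S}$ having probability mass at least $\eta$; or (ii) there is a sliding family containing an infinity of optimal intervals, all of the same length: specifically, there are a unique positive length $l^*_\eta$, a unique lower bound $\underline{a}_\eta$ and a unique upper bound $\overline{a}_\eta$ such that, for every left end $a$ within these bounds, the interval $\mathscr{S}^*_a = [a,\, a+l^*_\eta]$ has probability mass $\eta$ and minimizes the conditional variance $$\mathbb{E}\left[\left(X - \mathbb{E}[X \mid X\in \mathscr{S}]\right)^2 \,\middle|\, X\in \mathscr{S}\right]$$ over all silence sets $\mathscr{S}$ having probability mass at least $\eta$.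
   Context: A silence set is a measurable set $\mathscr{S}\subseteq\mathbb{R}$; its probability mass is $\mathbb{P}[X\in\mathscr{S}]$. A probability density is logarithmically concave (log-concave) if its logarithm is a concave function over its support.
   Formalization: Optimal intervals are taken inside the closed support (else uniqueness fails, e.g. Exp(1)); for η=1 with unbounded support the interval is the unbounded closed support; for η=0 the conditional variance is set to 0 and the family has length 0, with possibly infinite bounds. *)

theory Defs
  imports "HOL-Probability.Probability"
begin

text \<open>\<^const>\<open>concave_on\<close> includes convexity of the set, i.e. the support is an interval.\<close>

definition density_support :: "(real \<Rightarrow> real) \<Rightarrow> real set"
  where "density_support p = {x. 0 < p x}"

definition log_concave :: "(real \<Rightarrow> real) \<Rightarrow> bool"
  where "log_concave p \<longleftrightarrow> concave_on (density_support p) (\<lambda>x. ln (p x))"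

definition cond_expectation :: "'a measure \<Rightarrow> 'a set \<Rightarrow> ('a \<Rightarrow> real) \<Rightarrow> real"
  where "cond_expectation M A f = (\<integral>\<omega>. f \<omega> \<partial>uniform_measure M A)"

definition set_event :: "'a measure \<Rightarrow> ('a \<Rightarrow> real) \<Rightarrow> real set \<Rightarrow> 'a set"
  where "set_event M X S = {\<omega> \<in> space M. X \<omega> \<in> S}"

definition cond_variance :: "'a measure \<Rightarrow> ('a \<Rightarrow> real) \<Rightarrow> real set \<Rightarrow> real"
  where "cond_variance M X S =
    cond_expectation M (set_event M X S)
      (\<lambda>\<omega>. (X \<omega> - cond_expectation M (set_event M X S) X)\<^sup>2)"

text \<open>Mathematically the conditional variance is undefined on null events; here it is \<open>0\<close>,
  as if the conditional law were a point mass. Such events have mass at least \<open>\<eta>\<close> only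
  for \<open>\<eta> = 0\<close>, so no other case is affected.\<close>

lemma cond_variance_null:
  assumes "set_event M X S \<in> null_sets M"
  shows "cond_variance M X S = 0"
proof -
  let ?A = "set_event M X S"
  have A: "?A \<in> sets M" "emeasure M ?A = 0"
    using assms by auto
  have "emeasure (uniform_measure M ?A) (space M) = 0"
    using A by (subst emeasure_uniform_measure) auto
  then have "space (uniform_measure M ?A) \<in> null_sets (uniform_measure M ?A)"
    by (auto simp: null_sets_def)
  then have "AE \<omega> in uniform_measure M ?A. False"
    by (intro AE_I') auto
  then have "(\<integral>\<omega>. f \<omega> \<partial>uniform_measure M ?A) = 0" for f :: "'a \<Rightarrow> real"
    by (intro integral_eq_zero_AE) auto
  then show ?thesis
    by (simp add: cond_variance_def cond_expectation_def)
qed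

definition minimizes_cond_variance ::
    "'a measure \<Rightarrow> ('a \<Rightarrow> real) \<Rightarrow> real \<Rightarrow> real set \<Rightarrow> bool"
  where "minimizes_cond_variance M X \<eta> S \<longleftrightarrow>
    (\<forall>T \<in> sets borel. \<eta> \<le> measure M (set_event M X T) \<longrightarrow>
       cond_variance M X S \<le> cond_variance M X T)"

text \<open>The competitors in the minimization are arbitrary Borel sets. The optimal intervals
  themselves are taken inside the closed support of the density: extending an interval
  beyond the support changes neither its mass nor its conditional variance, so without this
  normalization neither an interval nor its length could be unique. Closed intervals may
  be unbounded, since for \<open>\<eta> = 1\<close> and unbounded support no bounded interval has mass \<open>\<eta>\<close>.\<close>

definition optimal_interval ::
    "'a measure \<Rightarrow> ('a \<Rightarrow> real) \<Rightarrow> (real \<Rightarrow> real) \<Rightarrow> real \<Rightarrow> real set \<Rightarrow> bool"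
  where "optimal_interval M X p \<eta> S \<longleftrightarrow>
    S \<noteq> {} \<and> closed S \<and> is_interval S \<and> S \<subseteq> closure (density_support p) \<and>
    measure M (set_event M X S) = \<eta> \<and> minimizes_cond_variance M X \<eta> S"

end

theory Submission
  imports Defs
begin

text \<open>
  Let \<open>F\<close> be the distribution function of \<open>X\<close> and \<open>Q\<close> its inverse on the open unit interval, so that
  \<open>X\<close> has the law of \<open>Q\<close> under the uniform measure. Conditioning on \<open>X \<in> T\<close> becomes averaging
  over the set of levels \<open>w\<close> with \<open>Q w \<in> T\<close>, a set whose length is the mass of \<open>T\<close>. The closed
  intervals of mass \<open>\<eta>\<close> inside the closed support correspond to the windows \<open>(u, u + \<eta>)\<close> with
  \<open>0 \<le> u \<le> 1 - \<eta>\<close>; \<open>window_var u\<close> is the conditional variance.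

  The main case is \<open>0 < \<eta> < 1\<close>.

  \<^item> Intervals suffice (\<open>bathtub\<close>): around any centre, hence around its own conditional mean, a set of
    mass at least \<open>\<eta>\<close> has a mean square deviation no smaller than that of a suitable window. On
    a window that attains the minimum \<open>Q\<close> is bounded, because equality forces its values into a ball.

  \<^item> The variance of a window is a convex function of its position (\<open>window_var_convex\<close>). For a
    log-concave density \<open>p\<close>, the function \<open>p \<circ> Q\<close> is concave (\<open>density_quantile_tangent\<close>), so
    \<open>Q' = 1 / (p \<circ> Q)\<close> is convex, so every increment \<open>Q (w + d) - Q w\<close> is a convex function of
    \<open>w\<close>. Therefore the interpolation between the values of \<open>Q\<close> on two windows differs from the values
    on the intermediate window by a nondecreasing function. Nondecreasing functions are nonnegatively
    correlated (\<open>variance_le_variance_add\<close>), so the interpolation has at least the variance of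
    the intermediate window, and the variance, a quadratic form, is convex along the interpolation.

  \<^item> Convexity and continuity give a compact interval of minimizers (\<open>minimizing_windows\<close>). If it
    contains two windows, then the convexity inequality is an equality between them, its
    defect is the variance of the difference of \<open>Q\<close> on the two windows, and this
    difference must be constant. Thus any two optimal intervals are translates of each other. One
    minimizer gives the unique optimal interval, several give the sliding family
    (\<open>optimal_intervals\<close>).

  The second moments involved are finite because a concave \<open>p \<circ> Q\<close> lies above a tent, which makes
  \<open>Q\<close> grow at most logarithmically at both ends of the unit interval.

  For \<open>\<eta> = 0\<close> the optimal intervals are exactly the points of the closed support, a sliding family
  of length zero. For \<open>\<eta> = 1\<close> no smaller closed set than the closed support has the required mass.
\<close>

section \<open>Uniform measures and variance\<close>

lemma
  fixes f :: "'a \<Rightarrow> real"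
  assumes A: "A \<in> sets M" "emeasure M A \<noteq> 0" "emeasure M A \<noteq> \<infinity>" and f: "f \<in> borel_measurable M"
  shows integral_uniform_measure:
      "(\<integral>x. f x \<partial>uniform_measure M A) = (\<integral>x. indicator A x * f x \<partial>M) / measure M A" (is ?I)
    and integrable_uniform_measure:
      "integrable (uniform_measure M A) f \<longleftrightarrow> integrable M (\<lambda>x. indicator A x * f x)" (is ?J)
proof -
  have pos: "measure M A > 0"
    using A by (simp add: emeasure_eq_ennreal_measure zero_less_measure_iff)
  have "uniform_measure M A = density M (\<lambda>x. ennreal (indicator A x / measure M A))"
    unfolding uniform_measure_def using A pos
    by (intro density_cong)
       (auto simp: emeasure_eq_ennreal_measure divide_ennreal[symmetric] split: split_indicator)
  then show ?I ?J
    using A(1) f pos integrable_mult_left_iff[of M "1 / measure M A" "\<lambda>x. indicator A x * f x"]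
    by (simp_all add: integral_density integrable_density)
qed

context prob_space
begin

lemma integrable_mult_of_squares:
  fixes f g :: "'a \<Rightarrow> real"
  assumes [measurable]: "random_variable borel f" "random_variable borel g"
    and f2: "integrable M (\<lambda>x. (f x)\<^sup>2)" and g2: "integrable M (\<lambda>x. (g x)\<^sup>2)"
  shows "integrable M (\<lambda>x. f x * g x)"
proof (rule Bochner_Integration.integrable_bound)
  show "integrable M (\<lambda>x. (f x)\<^sup>2 + (g x)\<^sup>2)"
    using f2 g2 by simp
  have "\<bar>a * b\<bar> \<le> a\<^sup>2 + b\<^sup>2" for a b :: real
  proof -
    have "2 * \<bar>a * b\<bar> \<le> a\<^sup>2 + b\<^sup>2"
      using sum_squares_bound[of "\<bar>a\<bar>" "\<bar>b\<bar>"] by (simp add: abs_mult)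
    then show ?thesis
      by linarith
  qed
  then show "AE x in M. norm (f x * g x) \<le> norm ((f x)\<^sup>2 + (g x)\<^sup>2)"
    by (intro AE_I2) (simp add: abs_mult)
qed measurable

lemma integrable_square_diff_const:
  fixes f :: "'a \<Rightarrow> real"
  assumes "random_variable borel f" "integrable M (\<lambda>x. (f x)\<^sup>2)"
  shows "integrable M (\<lambda>x. (f x - c)\<^sup>2)"
  using assms square_integrable_imp_integrable[OF assms] by (simp add: power2_diff)

lemma integrable_square_diff:
  fixes f g :: "'a \<Rightarrow> real"
  assumes "random_variable borel f" "random_variable borel g"
    "integrable M (\<lambda>x. (f x)\<^sup>2)" "integrable M (\<lambda>x. (g x)\<^sup>2)"
  shows "integrable M (\<lambda>x. (f x - g x)\<^sup>2)"
  using assms integrable_mult_of_squares[OF assms]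
  by (simp add: power2_diff mult.assoc)

lemma variance_le_second_moment:
  fixes f :: "'a \<Rightarrow> real"
  assumes "random_variable borel f" "integrable M (\<lambda>x. (f x)\<^sup>2)"
  shows "variance f \<le> expectation (\<lambda>x. (f x - c)\<^sup>2)"
proof -
  have i: "integrable M f"
    using square_integrable_imp_integrable[OF assms] .
  have "expectation (\<lambda>x. (f x - c)\<^sup>2) = expectation (\<lambda>x. (f x)\<^sup>2) - 2 * c * expectation f + c\<^sup>2"
    using assms i by (simp add: power2_diff prob_space algebra_simps)
  moreover have "variance f = expectation (\<lambda>x. (f x)\<^sup>2) - (expectation f)\<^sup>2"
    using assms i by (intro variance_eq)
  moreover have "0 \<le> (expectation f - c)\<^sup>2"
    by simp
  ultimately show ?thesis
    by (simp add: power2_diff mult_ac)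
qed

text \<open>Variance is a quadratic form, so along a segment it is a parabola whose leading coefficient is
  the variance of the difference of the endpoints.\<close>

lemma variance_convex_combination:
  fixes f g :: "'a \<Rightarrow> real"
  assumes mf: "random_variable borel f" and mg: "random_variable borel g"
    and f2: "integrable M (\<lambda>x. (f x)\<^sup>2)" and g2: "integrable M (\<lambda>x. (g x)\<^sup>2)"
  shows "variance (\<lambda>x. (1 - t) * f x + t * g x)
    = (1 - t) * variance f + t * variance g - t * (1 - t) * variance (\<lambda>x. f x - g x)"
proof -
  define a b where "a = expectation f" and "b = expectation g"
  have i: "integrable M f" "integrable M g"
    using square_integrable_imp_integrable assms by blast+
  have e1: "expectation (\<lambda>x. (1 - t) * f x + t * g x) = (1 - t) * a + t * b"
    and e2: "expectation (\<lambda>x. f x - g x) = a - b"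
    using i by (simp_all add: a_def b_def)
  have "integrable M (\<lambda>x. ((f x - a) - (g x - b))\<^sup>2)"
    using i assms by (intro integrable_square_diff integrable_square_diff_const) auto
  then have d2: "integrable M (\<lambda>x. (f x - g x - (a - b))\<^sup>2)"
    by (simp add: algebra_simps)
  have "((1 - t) * f x + t * g x - ((1 - t) * a + t * b))\<^sup>2
      = (1 - t) * (f x - a)\<^sup>2 + t * (g x - b)\<^sup>2 - t * (1 - t) * (f x - g x - (a - b))\<^sup>2" for x
    by (simp add: power2_eq_square algebra_simps)
  then show ?thesis
    unfolding e1 e2 a_def[symmetric] b_def[symmetric]
    using d2 integrable_square_diff_const[OF mf f2] integrable_square_diff_const[OF mg g2]
    by simp
qed

text \<open>The covariance of \<^term>\<open>h\<close> and \<^term>\<open>k\<close> is the expectation of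
  \<open>(h - \<mu>) (k - \<kappa>)\<close> for any constant \<^term>\<open>\<kappa>\<close>. If both factors always have the same sign, then
  the covariance is nonnegative, and adding \<^term>\<open>k\<close> to \<^term>\<open>h\<close> cannot reduce the variance.\<close>

lemma variance_le_variance_add:
  fixes h k :: "'a \<Rightarrow> real"
  assumes mh: "random_variable borel h" and mk: "random_variable borel k"
    and h2: "integrable M (\<lambda>x. (h x)\<^sup>2)" and k2: "integrable M (\<lambda>x. (k x)\<^sup>2)"
    and sgn: "AE x in M. 0 \<le> (h x - expectation h) * (k x - \<kappa>)"
  shows "variance h \<le> variance (\<lambda>x. h x + k x)"
proof -
  define a b where "a = expectation h" and "b = expectation k"
  have i: "integrable M h" "integrable M k"
    using square_integrable_imp_integrable assms by blast+
  have e: "expectation (\<lambda>x. h x + k x) = a + b"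
    using i by (simp add: a_def b_def)
  have i2: "integrable M (\<lambda>x. (h x - a)\<^sup>2)" "integrable M (\<lambda>x. (k x - b)\<^sup>2)"
      "integrable M (\<lambda>x. (h x - a) * (k x - \<kappa>))"
    using assms by (auto intro!: integrable_square_diff_const integrable_mult_of_squares)
  have "(h x + k x - (a + b))\<^sup>2 = (h x - a)\<^sup>2 + 2 * ((h x - a) * (k x - \<kappa>))
      + 2 * (\<kappa> - b) * (h x - a) + (k x - b)\<^sup>2" for x
    by (simp add: power2_eq_square algebra_simps)
  then have "variance (\<lambda>x. h x + k x) = variance h + 2 * expectation (\<lambda>x. (h x - a) * (k x - \<kappa>))
      + 2 * (\<kappa> - b) * expectation (\<lambda>x. h x - a) + variance k"
    unfolding e using i2 i by (simp add: a_def[symmetric] b_def[symmetric])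
  moreover have "expectation (\<lambda>x. h x - a) = 0"
    using i by (simp add: a_def prob_space)
  moreover have "0 \<le> expectation (\<lambda>x. (h x - a) * (k x - \<kappa>))"
    using sgn by (intro integral_nonneg_AE) (simp add: a_def)
  moreover have "0 \<le> variance k"
    by simp
  ultimately show ?thesis
    by simp
qed

end

definition mean_on :: "real set \<Rightarrow> (real \<Rightarrow> real) \<Rightarrow> real"
  where "mean_on A f = (\<integral>w. indicator A w * f w \<partial>lborel) / measure lborel A"

definition var_on :: "real set \<Rightarrow> (real \<Rightarrow> real) \<Rightarrow> real"
  where "var_on A f = mean_on A (\<lambda>w. (f w - mean_on A f)\<^sup>2)"

lemma mean_on_eq_uniform:
  assumes "A \<in> sets borel" "emeasure lborel A \<noteq> 0" "emeasure lborel A \<noteq> \<infinity>" "f \<in> borel_measurable borel"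
  shows "mean_on A f = (\<integral>w. f w \<partial>uniform_measure lborel A)"
  using assms by (simp add: mean_on_def integral_uniform_measure)

lemma mean_on_translate:
  "mean_on {u<..<u + d} f = mean_on {0<..<d} (\<lambda>s. f (u + s))"
proof -
  have "(\<integral>w. indicator {u<..<u + d} w * f w \<partial>lborel)
      = (\<integral>s. indicator {u<..<u + d} (u + 1 * s) * f (u + 1 * s) \<partial>lborel)"
    by (subst lborel_integral_real_affine[where c = 1 and t = u]) auto
  also have "\<dots> = (\<integral>s. indicator {0<..<d} s * f (u + s) \<partial>lborel)"
    by (intro Bochner_Integration.integral_cong) (auto split: split_indicator)
  finally show ?thesis
    by (cases "0 \<le> d") (auto simp: mean_on_def)
qed

lemma var_on_translate:
  "var_on {u<..<u + d} f = var_on {0<..<d} (\<lambda>s. f (u + s))"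
  by (simp add: var_on_def mean_on_translate)

lemma mean_on_AE_cong:
  assumes "A \<in> sets borel" "B \<in> sets borel" "AE w in lborel. w \<in> A \<longleftrightarrow> w \<in> B"
    and [measurable]: "f \<in> borel_measurable borel"
  shows "mean_on A f = mean_on B f"
proof -
  have [measurable]: "A \<in> sets borel" "B \<in> sets borel" by fact+
  have "measure lborel A = measure lborel B"
    using assms by (intro measure_eq_AE) auto
  moreover have "(\<integral>w. indicator A w * f w \<partial>lborel) = (\<integral>w. indicator B w * f w \<partial>lborel)"
    using assms(3) by (intro integral_cong_AE) (auto elim!: eventually_mono split: split_indicator)
  ultimately show ?thesis
    by (simp add: mean_on_def)
qed

lemma continuous_on_sliding_integral:
  fixes f :: "real \<Rightarrow> real"
  assumes f: "integrable lborel f" and d: "0 \<le> d"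
  shows "continuous_on {0..b} (\<lambda>u. \<integral>w. indicator {u<..<u + d} w * f w \<partial>lborel)"
proof -
  have hk: "f integrable_on {0..b + d}"
    using set_borel_integral_eq_integral(1)[of "{0..b + d}" f]
      integrable_mult_indicator[OF _ f, of "{0..b + d}"]
    by (simp add: set_integrable_def)
  have eq: "(\<integral>w. indicator {u<..<u + d} w * f w \<partial>lborel) = integral {0..u + d} f - integral {0..u} f"
    if u: "u \<in> {0..b}" for u
  proof -
    have "(\<integral>w. indicator {u<..<u + d} w * f w \<partial>lborel) = (\<integral>w. indicator {u..u + d} w *\<^sub>R f w \<partial>lborel)"
      using AE_lborel_singleton[of u] AE_lborel_singleton[of "u + d"] f
      by (intro integral_cong_AE) (auto elim!: eventually_elim2 split: split_indicator)
    also have "\<dots> = integral {u..u + d} f"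
      using set_borel_integral_eq_integral(2)[of "{u..u + d}" f]
        integrable_mult_indicator[OF _ f, of "{u..u + d}"]
      by (simp add: set_integrable_def set_lebesgue_integral_def)
    also have "\<dots> = integral {0..u + d} f - integral {0..u} f"
      using Henstock_Kurzweil_Integration.integral_combine[of 0 u "u + d" f] u d
        integrable_on_subinterval[OF hk, of 0 "u + d"] by auto
    finally show ?thesis .
  qed
  have "continuous_on {0..b} (\<lambda>u. integral {0..u + d} f - integral {0..u} f)"
  proof (intro continuous_on_diff)
    have c: "continuous_on {0..b + d} (\<lambda>x. integral {0..x} f)"
      using indefinite_integral_continuous_1[OF hk] .
    show "continuous_on {0..b} (\<lambda>u. integral {0..u + d} f)"
      using d by (intro continuous_on_compose2[OF c] continuous_intros) auto
    show "continuous_on {0..b} (\<lambda>u. integral {0..u} f)"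
      using d by (intro continuous_on_subset[OF c]) auto
  qed
  then show ?thesis
    by (rule continuous_on_eq) (simp add: eq)
qed

lemma AE_lborel_exists_in_interval:
  fixes a b :: real
  assumes "AE x in lborel. P x" "a < b"
  shows "\<exists>x\<in>{a<..<b}. P x"
proof (rule ccontr)
  assume "\<not> ?thesis"
  with assms(1) have "AE x in lborel. x \<notin> {a<..<b}"
    by (auto elim!: eventually_mono)
  then have "{a<..<b} \<in> null_sets lborel"
    by (subst AE_iff_null_sets) auto
  then have "emeasure lborel {a<..<b} = 0"
    by (rule null_setsD1)
  with \<open>a < b\<close> show False
    by simp
qed

lemma var_on_nonneg: "0 \<le> var_on A f"
  unfolding var_on_def mean_on_def by (intro divide_nonneg_nonneg integral_nonneg_AE) auto

section \<open>Sliding windows of a quantile function with convex increments\<close>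

text \<open>What log-concavity of a density means for its quantile function \<^term>\<open>Q\<close>: all increments over a
  fixed distance are convex functions of the position. The windows are the intervals of levels of
  length \<^term>\<open>\<eta>\<close>.\<close>

locale convex_quantile =
  fixes Q :: "real \<Rightarrow> real" and \<eta> :: real
  assumes eta: "0 < \<eta>" "\<eta> < 1"
    and Q_measurable [measurable]: "Q \<in> borel_measurable borel"
    and Q_outside: "w \<notin> {0<..<1} \<Longrightarrow> Q w = 0"
    and Q_square: "integrable lborel (\<lambda>w. (Q w)\<^sup>2)"
    and Q_cont: "continuous_on {0<..<1} Q"
    and Q_less: "0 < v \<Longrightarrow> v < w \<Longrightarrow> w < 1 \<Longrightarrow> Q v < Q w"
    and Q_increment: "0 < d \<Longrightarrow> d < 1 \<Longrightarrow> convex_on {0<..<1 - d} (\<lambda>w. Q (w + d) - Q w)"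
begin

lemma Q_less_iff: "v \<in> {0<..<1} \<Longrightarrow> w \<in> {0<..<1} \<Longrightarrow> Q v < Q w \<longleftrightarrow> v < w"
  using Q_less[of v w] Q_less[of w v] by (cases v w rule: linorder_cases) auto

lemma Q_le_iff: "v \<in> {0<..<1} \<Longrightarrow> w \<in> {0<..<1} \<Longrightarrow> Q v \<le> Q w \<longleftrightarrow> v \<le> w"
  using Q_less_iff[of w v] by (simp flip: not_less)

lemma Q_integrable: "integrable lborel Q"
proof (rule Bochner_Integration.integrable_bound)
  show "integrable lborel (\<lambda>w. indicator {0<..<1} w + (Q w)\<^sup>2 :: real)"
    using Q_square by (intro Bochner_Integration.integrable_add) simp_all
  have "\<bar>x\<bar> \<le> 1 + x\<^sup>2" for x :: real
  proof -
    have "0 \<le> (\<bar>x\<bar> - 1)\<^sup>2"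
      by simp
    then show ?thesis
      by (simp add: power2_diff)
  qed
  then have "\<bar>Q w\<bar> \<le> indicator {0<..<1} w + (Q w)\<^sup>2" for w
    using Q_outside[of w] by (auto split: split_indicator)
  then show "AE w in lborel. norm (Q w) \<le> norm (indicator {0<..<1} w + (Q w)\<^sup>2 :: real)"
    by (intro AE_I2) (simp add: order.trans[OF _ abs_ge_self])
qed simp

lemma Q_square_diff_integrable:
  assumes A: "A \<in> sets borel" "A \<subseteq> {0<..<1}"
  shows "integrable lborel (\<lambda>w. indicator A w * (Q w - c)\<^sup>2)"
proof -
  have "integrable lborel (\<lambda>w. indicator A w *\<^sub>R ((Q w)\<^sup>2 - 2 * c * Q w + c\<^sup>2 * indicator {0<..<1} w))"
    using Q_square Q_integrable A
    by (intro integrable_mult_indicator Bochner_Integration.integrable_add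
        Bochner_Integration.integrable_diff integrable_mult_right) auto
  also have "(\<lambda>w. indicator A w *\<^sub>R ((Q w)\<^sup>2 - 2 * c * Q w + c\<^sup>2 * indicator {0<..<1} w))
      = (\<lambda>w. indicator A w * (Q w - c)\<^sup>2)"
    using A(2) by (auto simp: fun_eq_iff power2_diff split: split_indicator)
  finally show ?thesis .
qed

lemma emeasure_subset_unit:
  assumes "A \<in> sets borel" "A \<subseteq> {0<..<1::real}"
  shows "emeasure lborel A = ennreal (measure lborel A)" "measure lborel A \<le> 1"
proof -
  have "emeasure lborel A \<le> emeasure lborel {0<..<1::real}"
    using assms by (intro emeasure_mono) auto
  then have le: "emeasure lborel A \<le> 1"
    by simp
  then show *: "emeasure lborel A = ennreal (measure lborel A)"
    by (intro emeasure_eq_ennreal_measure) (auto simp: top_unique)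
  show "measure lborel A \<le> 1"
    using le unfolding * by simp
qed

lemma var_on_le_mean_square:
  assumes A: "A \<in> sets borel" "A \<subseteq> {0<..<1}" and pos: "0 < measure lborel A"
  shows "var_on A Q \<le> mean_on A (\<lambda>w. (Q w - c)\<^sup>2)"
proof -
  have e: "emeasure lborel A \<noteq> 0" "emeasure lborel A \<noteq> \<infinity>"
    using emeasure_subset_unit[OF A] pos by auto
  interpret N: prob_space "uniform_measure lborel A"
    using e by (rule prob_space_uniform_measure)
  have "integrable (uniform_measure lborel A) (\<lambda>w. (Q w)\<^sup>2)"
    using Q_square_diff_integrable[OF A, of 0] e A by (simp add: integrable_uniform_measure)
  from N.variance_le_second_moment[OF _ this]
  show ?thesis
    unfolding var_on_def using e A by (simp add: mean_on_eq_uniform)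
qed

subsection \<open>The best set of given mass around a centre\<close>

text \<open>A window that contains the levels with values closest to \<^term>\<open>c\<close>: sliding the window until its two
  end values are equidistant from \<^term>\<open>c\<close> works, unless one end of the unit interval is reached first.
  The latter case is treated here for the left end.\<close>

lemma closest_window_at_left_end:
  fixes q :: "real \<Rightarrow> real"
  assumes cont: "continuous_on {0<..<1} q"
    and less: "\<And>v w. 0 < v \<Longrightarrow> v < w \<Longrightarrow> w < 1 \<Longrightarrow> q v < q w"
    and far: "\<And>u. 0 < u \<Longrightarrow> u < 1 - \<eta> \<Longrightarrow> 2 * c < q u + q (u + \<eta>)"
  shows "w \<in> {0<..<\<eta>} \<Longrightarrow> (q w - c)\<^sup>2 \<le> (q \<eta> - c)\<^sup>2"
    and "w \<in> {\<eta>..<1} \<Longrightarrow> (q \<eta> - c)\<^sup>2 \<le> (q w - c)\<^sup>2"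
proof -
  have sum: "2 * c \<le> q v + q \<eta>" if v: "v \<in> {0<..<\<eta>}" for v
  proof (rule tendsto_lowerbound)
    have "isCont q \<eta>"
      using cont eta by (simp add: continuous_on_eq_continuous_at)
    then have "((\<lambda>u. q (u + \<eta>)) \<longlongrightarrow> q \<eta>) (at 0)"
      using LIM_offset_zero[of q "q \<eta>" \<eta>] by (simp add: isCont_def add.commute)
    then have "((\<lambda>u. q (u + \<eta>)) \<longlongrightarrow> q \<eta>) (at_right 0)"
      by (rule tendsto_within_subset) simp
    then show "((\<lambda>u. q v + q (u + \<eta>)) \<longlongrightarrow> q v + q \<eta>) (at_right 0)"
      by (intro tendsto_intros)
    have "\<forall>\<^sub>F u in at_right 0. u \<in> {0<..<min v (1 - \<eta>)}"
      using v eta by (intro eventually_at_right_real) auto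
    then show "\<forall>\<^sub>F u in at_right 0. 2 * c \<le> q v + q (u + \<eta>)"
    proof eventually_elim
      case (elim u)
      then show ?case
        using far[of u] less[of u v] v eta by auto
    qed
  qed simp
  have c: "c \<le> q \<eta>"
    using sum[of "\<eta> / 2"] less[of "\<eta> / 2" \<eta>] eta by auto
  show "(q w - c)\<^sup>2 \<le> (q \<eta> - c)\<^sup>2" if "w \<in> {0<..<\<eta>}"
    using sum[of w] less[of w \<eta>] that eta by (intro power2_le_iff_abs_le[THEN iffD2]) auto
  show "(q \<eta> - c)\<^sup>2 \<le> (q w - c)\<^sup>2" if "w \<in> {\<eta>..<1}"
    using less[of \<eta> w] c that eta by (cases "w = \<eta>") (auto intro!: power_mono)
qed

lemma closest_window:
  obtains u K where "0 \<le> u" "u \<le> 1 - \<eta>"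
    "\<And>w. w \<in> {u<..<u + \<eta>} \<Longrightarrow> (Q w - c)\<^sup>2 \<le> K"
    "\<And>w. w \<in> {0<..<1} - {u<..<u + \<eta>} \<Longrightarrow> K \<le> (Q w - c)\<^sup>2"
proof -
  define S where "S u = Q u + Q (u + \<eta>) - 2 * c" for u
  have S_cont: "continuous_on {0<..<1 - \<eta>} S"
    unfolding S_def using eta
    by (intro continuous_intros continuous_on_compose2[OF Q_cont]) auto
  consider (root) u where "u \<in> {0<..<1 - \<eta>}" "S u = 0"
    | (pos) "\<And>u. u \<in> {0<..<1 - \<eta>} \<Longrightarrow> 0 < S u"
    | (neg) "\<And>u. u \<in> {0<..<1 - \<eta>} \<Longrightarrow> S u < 0"
  proof -
    have "connected (S ` {0<..<1 - \<eta>})"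
      using S_cont by (intro connected_continuous_image) auto
    then have "is_interval (S ` {0<..<1 - \<eta>})"
      by (simp add: is_interval_connected_1)
    then have "0 \<in> S ` {0<..<1 - \<eta>} \<or> (\<forall>x \<in> S ` {0<..<1 - \<eta>}. 0 < x) \<or> (\<forall>x \<in> S ` {0<..<1 - \<eta>}. x < 0)"
      unfolding is_interval_1 by (metis not_less)
    then show ?thesis
      using that by (auto simp: image_iff)
  qed
  then show ?thesis
  proof cases
    case root
    have le: "Q u \<le> Q w" if "w \<in> {0<..<1}" "u \<le> w" for w
      using that root eta by (subst Q_le_iff) auto
    have le': "Q w \<le> Q u" if "w \<in> {0<..<1}" "w \<le> u" for w
      using that root eta by (subst Q_le_iff) auto
    have le2: "Q (u + \<eta>) \<le> Q w" if "w \<in> {0<..<1}" "u + \<eta> \<le> w" for w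
      using that root eta by (subst Q_le_iff) auto
    have le2': "Q w \<le> Q (u + \<eta>)" if "w \<in> {0<..<1}" "w \<le> u + \<eta>" for w
      using that root eta by (subst Q_le_iff) auto
    have eq: "Q (u + \<eta>) - c = c - Q u" and c: "Q u \<le> c"
      using root le[of "u + \<eta>"] eta by (auto simp: S_def)
    show ?thesis
    proof (rule that[of u "(c - Q u)\<^sup>2"])
      fix w assume "w \<in> {u<..<u + \<eta>}"
      then show "(Q w - c)\<^sup>2 \<le> (c - Q u)\<^sup>2"
        using root eq c le[of w] le2'[of w] by (intro power2_le_iff_abs_le[THEN iffD2]) auto
    next
      fix w assume "w \<in> {0<..<1} - {u<..<u + \<eta>}"
      then have "\<bar>c - Q u\<bar> \<le> \<bar>Q w - c\<bar>"
        using root eq c le'[of w] le2[of w] by (cases "w \<le> u") auto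
      then show "(c - Q u)\<^sup>2 \<le> (Q w - c)\<^sup>2"
        by (simp add: abs_le_square_iff)
    qed (use root in auto)
  next
    case pos
    have far: "2 * c < Q u + Q (u + \<eta>)" if "0 < u" "u < 1 - \<eta>" for u
      using pos[of u] that by (simp add: S_def)
    show ?thesis
      using closest_window_at_left_end[OF Q_cont Q_less far] eta
      by (intro that[of 0 "(Q \<eta> - c)\<^sup>2"]) auto
  next
    case neg
    define q where "q w = - Q (1 - w)" for w
    have "continuous_on {0<..<1} q"
      unfolding q_def by (intro continuous_intros continuous_on_compose2[OF Q_cont]) auto
    moreover have "q v < q w" if "0 < v" "v < w" "w < 1" for v w
      using that Q_less[of "1 - w" "1 - v"] by (simp add: q_def)
    moreover have "2 * (- c) < q u + q (u + \<eta>)" if "0 < u" "u < 1 - \<eta>" for u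
      using neg[of "1 - \<eta> - u"] that by (simp add: S_def q_def algebra_simps)
    ultimately have *: "w \<in> {0<..<\<eta>} \<Longrightarrow> (q w - - c)\<^sup>2 \<le> (q \<eta> - - c)\<^sup>2"
        "w \<in> {\<eta>..<1} \<Longrightarrow> (q \<eta> - - c)\<^sup>2 \<le> (q w - - c)\<^sup>2" for w
      using closest_window_at_left_end[of q "- c"] by blast+
    have sq: "(q w - - c)\<^sup>2 = (Q (1 - w) - c)\<^sup>2" for w
      by (simp add: q_def power2_eq_square algebra_simps)
    show ?thesis
      using *(1)[of "1 - w" for w] *(2)[of "1 - w" for w] eta unfolding sq
      by (intro that[of "1 - \<eta>" "(Q (1 - \<eta>) - c)\<^sup>2"]) auto
  qed
qed

text \<open>The bathtub principle: replacing a set by the levels with values nearest to \<^term>\<open>c\<close>, of no larger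
  mass, cannot raise the mean square distance to \<^term>\<open>c\<close>. In the equality case the set is mapped, up to a null
  set, into a ball around \<^term>\<open>c\<close>.\<close>

lemma bathtub:
  assumes A: "A \<in> sets borel" "A \<subseteq> {0<..<1}" and mass: "\<eta> \<le> measure lborel A"
  obtains u K where "0 \<le> u" "u \<le> 1 - \<eta>"
    "mean_on {u<..<u + \<eta>} (\<lambda>w. (Q w - c)\<^sup>2) \<le> mean_on A (\<lambda>w. (Q w - c)\<^sup>2)"
    "measure lborel A = \<eta> \<Longrightarrow>
     mean_on A (\<lambda>w. (Q w - c)\<^sup>2) \<le> mean_on {u<..<u + \<eta>} (\<lambda>w. (Q w - c)\<^sup>2) \<Longrightarrow>
     AE w in lborel. w \<in> A \<longrightarrow> (Q w - c)\<^sup>2 \<le> K"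
proof -
  define m where "m = measure lborel A"
  have m: "\<eta> \<le> m" "0 < m"
    using mass eta by (auto simp: m_def)
  obtain u K where u: "0 \<le> u" "u \<le> 1 - \<eta>"
    and inside: "\<And>w. w \<in> {u<..<u + \<eta>} \<Longrightarrow> (Q w - c)\<^sup>2 \<le> K"
    and outside: "\<And>w. w \<in> {0<..<1} - {u<..<u + \<eta>} \<Longrightarrow> K \<le> (Q w - c)\<^sup>2"
    using closest_window[of c] by metis
  define I where "I = {u<..<u + \<eta>}"
  have I: "I \<in> sets borel" "I \<subseteq> {0<..<1}" "measure lborel I = \<eta>"
    using u eta by (auto simp: I_def)
  have [measurable]: "A \<in> sets borel" "I \<in> sets borel"
    using A I by auto
  define g where "g = (\<lambda>w. (Q w - c)\<^sup>2)"
  define gA gI where "gA = (\<integral>w. indicator A w * g w \<partial>lborel)" and "gI = (\<integral>w. indicator I w * g w \<partial>lborel)"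
  have int: "integrable lborel (\<lambda>w. indicator A w * g w)" "integrable lborel (\<lambda>w. indicator I w * g w)"
    unfolding g_def using A I by (auto intro: Q_square_diff_integrable)
  have fin: "integrable lborel (indicator A :: real \<Rightarrow> real)" "integrable lborel (indicator I :: real \<Rightarrow> real)"
    using emeasure_subset_unit[of A] emeasure_subset_unit[of I] A I by auto
  (* K - g is nonnegative on I and nonpositive off I, so the pointwise gain of replacing A by I is
     nonnegative, and it vanishes only where A and I agree or g = K. *)
  define gap where "gap w = indicator I w * (K - g w) - indicator A w * (K - g w)" for w
  have gap_eq: "gap = (\<lambda>w. (K * indicator I w - indicator I w * g w) - (K * indicator A w - indicator A w * g w))"
    by (auto simp: gap_def algebra_simps)
  have gap_int: "integrable lborel gap"
    unfolding gap_eq using int fin by (intro Bochner_Integration.integrable_diff integrable_mult_right)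
  have gap_nonneg: "0 \<le> gap w" for w
    using inside[of w] outside[of w] A(2) by (auto simp: gap_def g_def I_def split: split_indicator)
  have gap_integral: "(\<integral>w. gap w \<partial>lborel) = (K * \<eta> - gI) - (K * m - gA)"
    unfolding gap_eq using int fin I
    by (simp add: gA_def gI_def m_def)
  have gI_le: "gI \<le> K * \<eta>"
  proof -
    have "gI \<le> (\<integral>w. K * indicator I w \<partial>lborel)"
      unfolding gI_def using int fin inside
      by (intro integral_mono) (auto simp: g_def I_def split: split_indicator)
    then show ?thesis
      using I by simp
  qed
  have gap0: "0 \<le> (K * \<eta> - gI) - (K * m - gA)"
    using gap_nonneg by (simp flip: gap_integral)
  have means: "mean_on I g = gI / \<eta>" "mean_on A g = gA / m"
    using I by (simp_all add: mean_on_def gI_def gA_def m_def)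
  show ?thesis
  proof (rule that[OF u])
    have "gI * m = gI * \<eta> + gI * (m - \<eta>)"
      by (simp add: algebra_simps)
    also have "\<dots> \<le> gI * \<eta> + (K * \<eta>) * (m - \<eta>)"
      using gI_le m by (intro add_left_mono mult_right_mono) auto
    also have "\<dots> = (gI + K * (m - \<eta>)) * \<eta>"
      by (simp add: algebra_simps)
    also have "\<dots> \<le> gA * \<eta>"
      using gap0 eta by (intro mult_right_mono) (auto simp: algebra_simps)
    finally have "mean_on I g \<le> mean_on A g"
      unfolding means using m eta by (simp add: field_simps)
    then show "mean_on {u<..<u + \<eta>} (\<lambda>w. (Q w - c)\<^sup>2) \<le> mean_on A (\<lambda>w. (Q w - c)\<^sup>2)"
      by (simp add: I_def g_def)
  next
    assume "measure lborel A = \<eta>"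
      and "mean_on A (\<lambda>w. (Q w - c)\<^sup>2) \<le> mean_on {u<..<u + \<eta>} (\<lambda>w. (Q w - c)\<^sup>2)"
    then have "m = \<eta>" "mean_on A g \<le> mean_on I g"
      by (simp_all add: m_def I_def g_def)
    then have "gA \<le> gI"
      unfolding means using eta by (simp add: divide_le_cancel)
    then have "(\<integral>w. gap w \<partial>lborel) = 0"
      using gap0 \<open>m = \<eta>\<close> unfolding gap_integral by simp
    then have "AE w in lborel. gap w = 0"
      using integral_nonneg_eq_0_iff_AE[OF gap_int] gap_nonneg by simp
    then show "AE w in lborel. w \<in> A \<longrightarrow> (Q w - c)\<^sup>2 \<le> K"
    proof eventually_elim
      case (elim w)
      then show ?case
        using inside[of w] by (auto simp: gap_def g_def I_def split: split_indicator_asm)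
    qed
  qed
qed


subsection \<open>The variance of a window as a function of its position\<close>

definition window_var :: "real \<Rightarrow> real"
  where "window_var u = var_on {u<..<u + \<eta>} Q"

lemma prob_space_window: "prob_space (uniform_measure lborel {u<..<u + \<eta>})"
  using eta by (intro prob_space_uniform_measure) auto

lemma window_var_continuous: "continuous_on {0..1 - \<eta>} window_var"
proof -
  have "window_var u = (\<integral>w. indicator {u<..<u + \<eta>} w * (Q w)\<^sup>2 \<partial>lborel) / \<eta>
      - ((\<integral>w. indicator {u<..<u + \<eta>} w * Q w \<partial>lborel) / \<eta>)\<^sup>2" for u
  proof -
    interpret N: prob_space "uniform_measure lborel {u<..<u + \<eta>}"
      by (rule prob_space_window)
    have "integrable (uniform_measure lborel {u<..<u + \<eta>}) Q"
        "integrable (uniform_measure lborel {u<..<u + \<eta>}) (\<lambda>w. (Q w)\<^sup>2)"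
      using integrable_mult_indicator[OF _ Q_integrable, of "{u<..<u + \<eta>}"]
        integrable_mult_indicator[OF _ Q_square, of "{u<..<u + \<eta>}"] eta
      by (simp_all add: integrable_uniform_measure)
    from N.variance_eq[OF this] show ?thesis
      unfolding window_var_def var_on_def
      using eta by (simp flip: mean_on_eq_uniform) (simp add: mean_on_def)
  qed
  then show ?thesis
    using eta by (auto intro!: continuous_intros continuous_on_sliding_integral Q_integrable Q_square)
qed

lemma window_var_le_var_on:
  assumes A: "A \<in> sets borel" "A \<subseteq> {0<..<1}" and mass: "\<eta> \<le> measure lborel A"
  obtains u where "u \<in> {0..1 - \<eta>}" "window_var u \<le> var_on A Q"
proof -
  obtain u where u: "0 \<le> u" "u \<le> 1 - \<eta>"
    and le: "mean_on {u<..<u + \<eta>} (\<lambda>w. (Q w - mean_on A Q)\<^sup>2) \<le> var_on A Q"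
    unfolding var_on_def by (rule bathtub[OF assms])
  have "window_var u \<le> mean_on {u<..<u + \<eta>} (\<lambda>w. (Q w - mean_on A Q)\<^sup>2)"
    unfolding window_var_def using u eta by (intro var_on_le_mean_square) auto
  with le u show ?thesis
    by (intro that[of u]) auto
qed

text \<open>A window of minimal variance realizes equality in the bathtub principle centred at its own
  mean. So the quantile function stays within a bounded distance of that mean, and the window
  cannot correspond to an infinite interval.\<close>

lemma minimizer_bounded:
  assumes u: "u \<in> {0..1 - \<eta>}" and min: "\<And>v. v \<in> {0..1 - \<eta>} \<Longrightarrow> window_var u \<le> window_var v"
  shows "bounded (Q ` {u<..<u + \<eta>})"
proof -
  define I where "I = {u<..<u + \<eta>}"
  have I: "I \<in> sets borel" "I \<subseteq> {0<..<1}" "measure lborel I = \<eta>"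
    using u eta by (auto simp: I_def)
  define c where "c = mean_on I Q"
  obtain v K where v: "0 \<le> v" "v \<le> 1 - \<eta>"
    and K: "mean_on I (\<lambda>w. (Q w - c)\<^sup>2) \<le> mean_on {v<..<v + \<eta>} (\<lambda>w. (Q w - c)\<^sup>2) \<Longrightarrow>
      AE w in lborel. w \<in> I \<longrightarrow> (Q w - c)\<^sup>2 \<le> K"
  proof (rule bathtub[OF I(1,2)])
    show "\<eta> \<le> measure lborel I"
      using I by simp
    fix v K
    assume "0 \<le> v" "v \<le> 1 - \<eta>"
      and "measure lborel I = \<eta> \<Longrightarrow>
        mean_on I (\<lambda>w. (Q w - c)\<^sup>2) \<le> mean_on {v<..<v + \<eta>} (\<lambda>w. (Q w - c)\<^sup>2) \<Longrightarrow>
        AE w in lborel. w \<in> I \<longrightarrow> (Q w - c)\<^sup>2 \<le> K"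
    then show thesis
      using I(3) that by blast
  qed
  have "mean_on I (\<lambda>w. (Q w - c)\<^sup>2) = window_var u"
    by (simp add: window_var_def var_on_def I_def c_def)
  also have "\<dots> \<le> window_var v"
    using v by (intro min) auto
  also have "\<dots> \<le> mean_on {v<..<v + \<eta>} (\<lambda>w. (Q w - c)\<^sup>2)"
    unfolding window_var_def using v eta by (intro var_on_le_mean_square) auto
  finally have AE: "AE w in lborel. w \<in> I \<longrightarrow> (Q w - c)\<^sup>2 \<le> K"
    by (rule K)
  have "norm (Q w) \<le> \<bar>c\<bar> + sqrt K" if w: "w \<in> {u<..<u + \<eta>}" for w
  proof -
    have near: "\<bar>Q x - c\<bar> \<le> sqrt K" if "(Q x - c)\<^sup>2 \<le> K" for x
      using that real_le_rsqrt[of "\<bar>Q x - c\<bar>" K] by simp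
    obtain x where x: "x \<in> {u<..<w}" "(Q x - c)\<^sup>2 \<le> K"
      using AE_lborel_exists_in_interval[OF AE, of u w] w by (auto simp: I_def)
    obtain y where y: "y \<in> {w<..<u + \<eta>}" "(Q y - c)\<^sup>2 \<le> K"
      using AE_lborel_exists_in_interval[OF AE, of w "u + \<eta>"] w by (auto simp: I_def)
    have "Q x < Q w" "Q w < Q y"
      using x y w u by (auto intro!: Q_less)
    then show ?thesis
      using near[OF x(2)] near[OF y(2)] by auto
  qed
  then show ?thesis
    by (intro boundedI[where B = "\<bar>c\<bar> + sqrt K"]) auto
qed

text \<open>Convexity of the increments of \<^term>\<open>Q\<close> says that, inside the window, the interpolation
  \<open>f = (1 - t) Q (u + s) + t Q (v + s)\<close> increases at least as fast in \<^term>\<open>s\<close> as the values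
  \<open>h = Q (z + s)\<close> in the intermediate window. So \<^term>\<open>h\<close> and \<open>f - h\<close> are both nondecreasing in
  \<^term>\<open>s\<close>, hence nonnegatively correlated, and \<^term>\<open>f\<close> has at least the variance of \<^term>\<open>h\<close>.\<close>

lemma window_var_convex:
  assumes u: "u \<in> {0..1 - \<eta>}" and v: "v \<in> {0..1 - \<eta>}" and t: "0 \<le> t" "t \<le> 1"
  shows "window_var ((1 - t) * u + t * v)
    \<le> (1 - t) * window_var u + t * window_var v - t * (1 - t) * var_on {0<..<\<eta>} (\<lambda>s. Q (u + s) - Q (v + s))"
proof -
  define N where "N = uniform_measure lborel {0<..<\<eta>}"
  interpret N: prob_space N
    unfolding N_def using prob_space_window[of 0] by simp
  have meanN: "mean_on {0<..<\<eta>} f = N.expectation f" if "f \<in> borel_measurable borel" for f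
    unfolding N_def using eta that by (intro mean_on_eq_uniform) auto
  have varN: "var_on {0<..<\<eta>} f = N.variance f" if [measurable]: "f \<in> borel_measurable borel" for f
    by (simp add: var_on_def meanN)
  have AE_N: "AE s in N. s \<in> {0<..<\<eta>}"
    unfolding N_def by (intro AE_uniform_measureI) auto
  have sets_N: "sets N = sets borel"
    by (simp add: N_def)
  have meas_N: "f \<in> borel_measurable N \<longleftrightarrow> f \<in> borel_measurable borel" for f :: "real \<Rightarrow> real"
    by (subst measurable_cong_sets[OF sets_N refl]) (rule refl)
  define z where "z = (1 - t) * u + t * v"
  have z: "z \<in> {0..1 - \<eta>}"
    unfolding z_def using convexD_alt[of "{0..1 - \<eta>}" u v t] u v t by simp
  define h where "h s = Q (z + s)" for s
  define f where "f s = (1 - t) * Q (u + s) + t * Q (v + s)" for s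
  define k where "k s = f s - h s" for s
  have sq: "integrable N (\<lambda>s. (Q (x + s))\<^sup>2)" for x
    unfolding N_def using integrable_mult_indicator[OF _ lborel_integrable_real_affine[OF Q_square, of 1 x], of "{0<..<\<eta>}"] eta
    by (subst integrable_uniform_measure) auto
  have meas: "(\<lambda>s. Q (x + s)) \<in> borel_measurable N" for x
    by (simp add: meas_N)
  have f_meas: "f \<in> borel_measurable N" and h_meas: "h \<in> borel_measurable N" and k_meas: "k \<in> borel_measurable N"
    unfolding k_def f_def h_def by (simp_all add: meas_N)
  have f_sq: "integrable N (\<lambda>s. (f s)\<^sup>2)"
    unfolding f_def using sq N.integrable_mult_of_squares[OF meas meas sq sq, of u v]
    by (simp add: power2_sum power_mult_distrib mult_ac)
  have h_sq: "integrable N (\<lambda>s. (h s)\<^sup>2)"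
    unfolding h_def by (rule sq)
  have k_sq: "integrable N (\<lambda>s. (k s)\<^sup>2)"
    unfolding k_def using f_meas h_meas f_sq h_sq by (rule N.integrable_square_diff)
  have h_mono: "h r < h s" if "0 < r" "r < s" "s < \<eta>" for r s
    unfolding h_def using that z by (intro Q_less) auto
  have k_mono: "k r \<le> k s" if "0 < r" "r < s" "s < \<eta>" for r s
  proof -
    have "convex_on {0<..<1 - (s - r)} (\<lambda>w. Q (w + (s - r)) - Q w)"
      using that eta by (intro Q_increment) auto
    from convex_onD[OF this t, of "u + r" "v + r"]
    show ?thesis
      using that u v by (simp add: k_def f_def h_def z_def algebra_simps)
  qed
  define m where "m = N.expectation h"
  have "integrable N h"
    using N.square_integrable_imp_integrable[OF h_meas h_sq] .
  (* At the level s0 where h crosses its mean, k is used as the reference value of the covariance. *)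
  obtain s0 where s0: "s0 \<in> {0<..<\<eta>}" "h s0 = m"
  proof (rule ccontr)
    assume "\<not> thesis"
    then have "m \<notin> h ` {0<..<\<eta>}"
      using that by (metis imageE)
    moreover have "is_interval (h ` {0<..<\<eta>})"
      unfolding is_interval_connected_1 h_def using z
      by (intro connected_continuous_image continuous_intros continuous_on_compose2[OF Q_cont]) auto
    ultimately have "(\<forall>x \<in> h ` {0<..<\<eta>}. m < x) \<or> (\<forall>x \<in> h ` {0<..<\<eta>}. x < m)"
      unfolding is_interval_1 by (metis not_less)
    then consider "\<And>s. s \<in> {0<..<\<eta>} \<Longrightarrow> m < h s" | "\<And>s. s \<in> {0<..<\<eta>} \<Longrightarrow> h s < m"
      by blast
    then show False
    proof cases
      case 1
      then have "AE s in N. m < h s"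
        using AE_N by (auto elim: eventually_mono)
      then show False
        using N.expectation_greater[OF \<open>integrable N h\<close>, of m] unfolding m_def by blast
    next
      case 2
      then have "AE s in N. h s < m"
        using AE_N by (auto elim: eventually_mono)
      then show False
        using N.expectation_less[OF \<open>integrable N h\<close>, of m] unfolding m_def by blast
    qed
  qed
  have "AE s in N. 0 \<le> (h s - m) * (k s - k s0)"
    using AE_N
  proof eventually_elim
    case (elim s)
    then show ?case
      using s0 h_mono[of s s0] h_mono[of s0 s] k_mono[of s s0] k_mono[of s0 s]
      by (cases s s0 rule: linorder_cases) (auto intro: mult_nonneg_nonneg mult_nonpos_nonpos)
  qed
  then have "N.variance h \<le> N.variance (\<lambda>s. h s + k s)"
    unfolding m_def by (rule N.variance_le_variance_add[OF h_meas k_meas h_sq k_sq])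
  also have "\<dots> = N.variance f"
    by (simp add: k_def)
  also have "\<dots> = (1 - t) * N.variance (\<lambda>s. Q (u + s)) + t * N.variance (\<lambda>s. Q (v + s))
      - t * (1 - t) * N.variance (\<lambda>s. Q (u + s) - Q (v + s))"
    unfolding f_def by (rule N.variance_convex_combination[OF meas meas sq sq])
  finally show ?thesis
    unfolding window_var_def var_on_translate z_def[symmetric] h_def by (simp add: varN)
qed

text \<open>A random variable of variance zero is constant almost everywhere; by continuity the
  difference of the values of \<^term>\<open>Q\<close> on the two windows is then constant everywhere.\<close>

lemma translate_of_var_on_zero:
  assumes u: "u \<in> {0..1 - \<eta>}" and v: "v \<in> {0..1 - \<eta>}"
    and zero: "var_on {0<..<\<eta>} (\<lambda>s. Q (u + s) - Q (v + s)) = 0"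
  obtains k where "\<And>s. s \<in> {0<..<\<eta>} \<Longrightarrow> Q (u + s) = Q (v + s) + k"
proof -
  define F where "F s = Q (u + s) - Q (v + s)" for s
  define m where "m = mean_on {0<..<\<eta>} F"
  have F_cont: "continuous_on {0<..<\<eta>} F"
    unfolding F_def using u v by (intro continuous_intros continuous_on_compose2[OF Q_cont]) auto
  have "integrable lborel (\<lambda>s. indicator {0<..<\<eta>} s * (F s - m)\<^sup>2)"
  proof -
    interpret N: prob_space "uniform_measure lborel {0<..<\<eta>}"
      using prob_space_window[of 0] by simp
    have sq: "integrable (uniform_measure lborel {0<..<\<eta>}) (\<lambda>s. (Q (x + s))\<^sup>2)" for x
      using integrable_mult_indicator[OF _ lborel_integrable_real_affine[OF Q_square, of 1 x], of "{0<..<\<eta>}"] eta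
      by (subst integrable_uniform_measure) auto
    have "integrable (uniform_measure lborel {0<..<\<eta>}) (\<lambda>s. (F s - m)\<^sup>2)"
      unfolding F_def using sq by (intro N.integrable_square_diff_const N.integrable_square_diff) simp_all
    then show ?thesis
      using eta by (subst (asm) integrable_uniform_measure) (auto simp: F_def)
  qed
  moreover have "(\<integral>s. indicator {0<..<\<eta>} s * (F s - m)\<^sup>2 \<partial>lborel) = 0"
    using zero eta by (simp add: var_on_def mean_on_def F_def m_def)
  ultimately have "AE s in lborel. indicator {0<..<\<eta>} s * (F s - m)\<^sup>2 = 0"
    using integral_nonneg_eq_0_iff_AE[of lborel "\<lambda>s. indicator {0<..<\<eta>} s * (F s - m)\<^sup>2"] by simp
  then have AE: "AE s in lborel. s \<in> {0<..<\<eta>} \<longrightarrow> F s = m"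
    by eventually_elim (auto split: split_indicator_asm)
  have "F s = m" if s: "s \<in> {0<..<\<eta>}" for s
  proof (rule ccontr)
    assume "F s \<noteq> m"
    have "open ({0<..<\<eta>} \<inter> F -` (- {m}))"
      using F_cont by (intro continuous_open_preimage) auto
    moreover have "s \<in> {0<..<\<eta>} \<inter> F -` (- {m})"
      using s \<open>F s \<noteq> m\<close> by simp
    ultimately obtain e where "e > 0" "ball s e \<subseteq> {0<..<\<eta>} \<inter> F -` (- {m})"
      by (meson open_contains_ball)
    moreover have "s - e < s + e"
      using \<open>e > 0\<close> by simp
    from AE_lborel_exists_in_interval[OF AE this]
    obtain y where y: "y \<in> {s - e<..<s + e}" "y \<in> {0<..<\<eta>} \<longrightarrow> F y = m"
      by blast
    moreover have "y \<in> ball s e"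
      using y(1) by (simp add: dist_real_def abs_less_iff)
    ultimately show False
      by blast
  qed
  then show ?thesis
    by (intro that[of m]) (simp add: F_def algebra_simps)
qed

text \<open>Between two minimizers the inequality in \<open>window_var_convex\<close> leaves no room for the
  subtracted variance, which therefore vanishes.\<close>

lemma minimizing_windows:
  obtains lo hi where "0 \<le> lo" "lo \<le> hi" "hi \<le> 1 - \<eta>"
    "\<And>u. u \<in> {lo..hi} \<longleftrightarrow> u \<in> {0..1 - \<eta>} \<and> (\<forall>v\<in>{0..1 - \<eta>}. window_var u \<le> window_var v)"
    "\<And>u v. u \<in> {lo..hi} \<Longrightarrow> v \<in> {lo..hi} \<Longrightarrow> \<exists>k. \<forall>s\<in>{0<..<\<eta>}. Q (u + s) = Q (v + s) + k"
proof -
  obtain u0 where u0: "u0 \<in> {0..1 - \<eta>}" "\<And>v. v \<in> {0..1 - \<eta>} \<Longrightarrow> window_var u0 \<le> window_var v"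
    using continuous_attains_inf[OF _ _ window_var_continuous] eta by auto
  define Min where "Min = {u \<in> {0..1 - \<eta>}. window_var u \<le> window_var u0}"
  have Min_eq: "window_var u = window_var u0" if "u \<in> Min" for u
    using that u0 by (auto simp: Min_def intro: antisym)
  have "Min = {0..1 - \<eta>} \<inter> window_var -` {..window_var u0}"
    by (auto simp: Min_def)
  then have "closed Min"
    using window_var_continuous by (simp add: continuous_closed_preimage)
  moreover have "bounded Min"
    by (rule bounded_subset[OF bounded_closed_interval[of 0 "1 - \<eta>"]]) (auto simp: Min_def)
  ultimately have "compact Min"
    by (simp add: compact_eq_bounded_closed)
  have combination: "(1 - t) * u + t * v \<in> Min
      \<and> t * (1 - t) * var_on {0<..<\<eta>} (\<lambda>s. Q (u + s) - Q (v + s)) \<le> 0"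
    if "u \<in> Min" "v \<in> Min" "0 \<le> t" "t \<le> 1" for u v t
  proof -
    define D where "D = t * (1 - t) * var_on {0<..<\<eta>} (\<lambda>s. Q (u + s) - Q (v + s))"
    have uv: "u \<in> {0..1 - \<eta>}" "v \<in> {0..1 - \<eta>}" "window_var u = window_var u0" "window_var v = window_var u0"
      using that(1,2) Min_eq[OF that(1)] Min_eq[OF that(2)] by (simp_all add: Min_def)
    have "window_var ((1 - t) * u + t * v) \<le> window_var u0 - D"
      using window_var_convex[OF uv(1,2) that(3,4)] unfolding D_def uv(3,4) by (simp add: algebra_simps)
    moreover have "0 \<le> D"
      unfolding D_def using that by (intro mult_nonneg_nonneg var_on_nonneg) auto
    moreover have z: "(1 - t) * u + t * v \<in> {0..1 - \<eta>}"
      using convexD_alt[of "{0..1 - \<eta>}" u v t] uv that by simp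
    ultimately show ?thesis
      using u0(2)[OF z] unfolding Min_def D_def[symmetric] by auto
  qed
  have "convex Min"
    unfolding convex_alt using combination by auto
  then have "connected Min"
    by (rule convex_connected)
  with \<open>compact Min\<close> obtain lo hi where Min: "Min = {lo..hi}"
    using connected_compact_interval_1 by blast
  have "u0 \<in> Min"
    using u0 by (simp add: Min_def)
  then have "lo \<le> hi"
    by (simp add: Min)
  then have lohi: "lo \<in> Min" "hi \<in> Min"
    by (simp_all add: Min)
  show ?thesis
  proof (rule that[of lo hi])
    show "0 \<le> lo" "hi \<le> 1 - \<eta>"
      using lohi by (auto simp: Min_def)
    show "u \<in> {lo..hi} \<longleftrightarrow> u \<in> {0..1 - \<eta>} \<and> (\<forall>v\<in>{0..1 - \<eta>}. window_var u \<le> window_var v)" for u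
      unfolding Min[symmetric] Min_def using u0 by (auto intro: order.trans)
    show "\<exists>k. \<forall>s\<in>{0<..<\<eta>}. Q (u + s) = Q (v + s) + k" if "u \<in> {lo..hi}" "v \<in> {lo..hi}" for u v
    proof -
      have "var_on {0<..<\<eta>} (\<lambda>s. Q (u + s) - Q (v + s)) \<le> 0"
        using combination[of u v "1 / 2"] that by (simp add: Min)
      then have "var_on {0<..<\<eta>} (\<lambda>s. Q (u + s) - Q (v + s)) = 0"
        using var_on_nonneg by (rule antisym)
      then obtain k where "\<And>s. s \<in> {0<..<\<eta>} \<Longrightarrow> Q (u + s) = Q (v + s) + k"
        using translate_of_var_on_zero[of u v] \<open>u \<in> {lo..hi}\<close> \<open>v \<in> {lo..hi}\<close>
        unfolding Min[symmetric] Min_def by blast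
      then show ?thesis
        by blast
    qed
  qed (fact \<open>lo \<le> hi\<close>)
qed

end

section \<open>The quantile function of a log-concave density\<close>

text \<open>The estimate behind the concavity of \<open>p \<circ> F\<^sup>-\<^sup>1\<close>, for \<open>q = G'\<close>. If the exponential tangent
  decreases, then it bounds \<^term>\<open>q\<close> from above and the integral of \<^term>\<open>q\<close> is compared with the
  integral of the tangent. Otherwise only \<open>q h > q 0\<close> is of interest, and the comparison is with the
  increasing exponential chord from \<open>0\<close> to \<^term>\<open>h\<close>, which bounds \<^term>\<open>q\<close> from below.\<close>

lemma log_concave_tangent_increment:
  fixes q G :: "real \<Rightarrow> real"
  assumes h: "0 < h"
    and pos: "\<And>t. 0 \<le> t \<Longrightarrow> t \<le> h \<Longrightarrow> 0 < q t"
    and deriv: "\<And>t. 0 \<le> t \<Longrightarrow> t \<le> h \<Longrightarrow> (G has_real_derivative q t) (at t)"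
    and chord: "\<And>t. 0 \<le> t \<Longrightarrow> t \<le> h \<Longrightarrow> (1 - t / h) * ln (q 0) + t / h * ln (q h) \<le> ln (q t)"
    and tangent: "\<And>t. 0 \<le> t \<Longrightarrow> t \<le> h \<Longrightarrow> q t \<le> q 0 * exp (k * t)"
  shows "q h - q 0 \<le> k * (G h - G 0)"
proof -
  have exp_compare: "q 0 * exp (m * h) - q 0 \<le> m * (G h - G 0)"
    if "\<And>t. 0 \<le> t \<Longrightarrow> t \<le> h \<Longrightarrow> 0 \<le> m * (q t - q 0 * exp (m * t))" for m
  proof -
    have "m * G 0 - q 0 * exp (m * 0) \<le> m * G h - q 0 * exp (m * h)"
    proof (rule DERIV_nonneg_imp_nondecreasing[where f = "\<lambda>t. m * G t - q 0 * exp (m * t)"])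
      show "0 \<le> h"
        using h by simp
      fix t assume t: "0 \<le> t" "t \<le> h"
      have "((\<lambda>t. m * G t - q 0 * exp (m * t)) has_real_derivative m * (q t - q 0 * exp (m * t))) (at t)"
        by (rule derivative_eq_intros deriv t refl)+ (simp add: algebra_simps)
      then show "\<exists>y. ((\<lambda>t. m * G t - q 0 * exp (m * t)) has_real_derivative y) (at t) \<and> 0 \<le> y"
        using that[OF t] by blast
    qed
    then show ?thesis
      by (simp add: algebra_simps)
  qed
  show ?thesis
  proof (cases "k \<le> 0")
    case True
    have "q 0 * exp (k * h) - q 0 \<le> k * (G h - G 0)"
      using True tangent by (intro exp_compare mult_nonpos_nonpos) auto
    then show ?thesis
      using tangent[of h] h by simp
  next
    case False
    have "G 0 \<le> G h"
      using h pos deriv by (intro DERIV_nonneg_imp_nondecreasing[of 0 h G]) (auto intro: less_imp_le)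
    show ?thesis
    proof (cases "q h \<le> q 0")
      case True
      moreover have "0 \<le> k * (G h - G 0)"
        using False \<open>G 0 \<le> G h\<close> by simp
      ultimately show ?thesis
        by linarith
    next
      case gr: False
      define m where "m = (ln (q h) - ln (q 0)) / h"
      have q0: "0 < q 0" and qh: "0 < q h"
        using pos h by auto
      have m_pos: "0 < m"
        using gr q0 qh h by (simp add: m_def)
      have mh: "q 0 * exp (m * h) = q h"
        using q0 qh h by (simp add: m_def exp_diff)
      have "exp (m * h) \<le> exp (k * h)"
        using tangent[of h] h q0 by (simp flip: mh)
      then have "m \<le> k"
        using h by simp
      have "q 0 * exp (m * t) \<le> q t" if t: "0 \<le> t" "t \<le> h" for t
      proof -
        have "ln (q 0) + m * t = (1 - t / h) * ln (q 0) + t / h * ln (q h)"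
          using h by (simp add: m_def field_simps)
        also have "\<dots> \<le> ln (q t)"
          using chord[OF t] .
        finally have "exp (ln (q 0) + m * t) \<le> exp (ln (q t))"
          by simp
        then show ?thesis
          using q0 pos[OF t] by (simp add: exp_add)
      qed
      then have "q 0 * exp (m * h) - q 0 \<le> m * (G h - G 0)"
        using m_pos by (intro exp_compare) auto
      also have "\<dots> \<le> k * (G h - G 0)"
        using \<open>m \<le> k\<close> \<open>G 0 \<le> G h\<close> by (intro mult_right_mono) auto
      finally show ?thesis
        unfolding mh .
    qed
  qed
qed

text \<open>The points \<open>x + d\<close> and \<^term>\<open>y\<close> lie between \<^term>\<open>x\<close> and \<open>y + d\<close> with complementary barycentric
  weights, so adding the two convexity inequalities gives the claim.\<close>

lemma convex_on_increment_mono: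
  fixes J :: "real \<Rightarrow> real"
  assumes J: "convex_on A J" and "x \<in> A" "y + d \<in> A" "x \<le> y" "0 \<le> d"
  shows "J (x + d) - J x \<le> J (y + d) - J y"
proof (cases "y + d = x")
  case True
  then have "d = 0" "y = x"
    using assms by auto
  then show ?thesis
    by simp
next
  case False
  define L where "L = y + d - x"
  have L: "0 < L"
    using False assms by (simp add: L_def)
  define t where "t = (y - x) / L"
  have t: "0 \<le> t" "t \<le> 1"
    using L assms by (auto simp: t_def L_def)
  have tL: "t * L = y - x"
    using L by (simp add: t_def)
  have "(1 - t) * x + t * (y + d) = x + t * L" "(1 - (1 - t)) * x + (1 - t) * (y + d) = x + L - t * L"
    by (simp_all add: L_def algebra_simps)
  then have e: "(1 - t) * x + t * (y + d) = y" "(1 - (1 - t)) * x + (1 - t) * (y + d) = x + d"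
    unfolding tL by (simp_all add: L_def)
  have "J y \<le> (1 - t) * J x + t * J (y + d)"
    using convex_onD[OF J t assms(2,3)] e by simp
  moreover have "J (x + d) \<le> (1 - (1 - t)) * J x + (1 - t) * J (y + d)"
    using convex_onD[OF J, of "1 - t" x "y + d"] t assms(2,3) e by simp
  ultimately show ?thesis
    by (simp add: algebra_simps)
qed

lemma ln_square_integrable:
  "integrable lborel (\<lambda>w::real. indicator {0<..<1} w * (ln w)\<^sup>2)"
proof (rule Bochner_Integration.integrable_bound)
  define f where "f w = (if w \<in> {0..1} then w powr (- 1 / 2) else 0)" for w :: real
  have [measurable]: "f \<in> borel_measurable borel"
    unfolding f_def by measurable
  have "((\<lambda>w::real. w powr (- 1 / 2)) has_integral 2) {0..1}"
    using has_integral_powr_from_0[of "- 1 / 2" 1] by simp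
  then have "(f has_integral 2) UNIV"
    unfolding f_def by (subst has_integral_restrict_UNIV)
  then have "(\<integral>\<^sup>+ w. ennreal (f w) \<partial>lborel) = 2"
    by (subst nn_integral_has_integral_lborel[of f 2]) (auto simp: f_def)
  then have "integrable lborel f"
    by (intro integrableI_nonneg) (auto simp: f_def)
  then show "integrable lborel (\<lambda>w. 16 * f w)"
    by simp
  show "AE w in lborel. norm (indicator {0<..<1} w * (ln w)\<^sup>2) \<le> norm (16 * f w)"
  proof (intro AE_I2)
    fix w :: real
    have "(ln w)\<^sup>2 \<le> 16 * w powr (- 1 / 2)" if w: "0 < w" "w < 1"
    proof -
      (* The exponent 1/4 leaves w powr (-1/2) after squaring, which is integrable at 0. *)
      have "ln (1 / w) \<le> (1 / w) powr (1 / 4) / (1 / 4)"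
        using w by (intro ln_powr_bound) auto
      then have "- ln w \<le> 4 * (1 / w) powr (1 / 4)"
        using w by (simp add: ln_div)
      then have "(- ln w)\<^sup>2 \<le> (4 * (1 / w) powr (1 / 4))\<^sup>2"
        using w by (intro power_mono) auto
      also have "\<dots> = 16 * ((1 / w) powr (1 / 4) * (1 / w) powr (1 / 4))"
        by (simp add: power2_eq_square)
      also have "\<dots> = 16 * (1 / w) powr (1 / 2)"
        by (simp flip: powr_add)
      also have "(1 / w) powr (1 / 2) = w powr (- 1 / 2)"
        using w by (simp add: powr_minus powr_divide inverse_eq_divide)
      finally show ?thesis
        by simp
    qed
    then show "norm (indicator {0<..<1} w * (ln w)\<^sup>2) \<le> norm (16 * f w)"
      by (auto simp: f_def split: split_indicator)
  qed
qed simp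

locale log_concave_density =
  fixes p :: "real \<Rightarrow> real"
  assumes p_nonneg: "0 \<le> p x"
    and p_measurable [measurable]: "p \<in> borel_measurable borel"
    and p_total: "(\<integral>\<^sup>+ x. ennreal (p x) \<partial>lborel) = 1"
    and p_log_concave: "log_concave p"
begin

definition law :: "real measure"
  where "law = density lborel (\<lambda>x. ennreal (p x))"

definition U :: "real set"
  where "U = interior (density_support p)"

sublocale law: cdf_distribution law
proof -
  have "prob_space law"
    using p_total by (intro prob_spaceI) (simp add: law_def emeasure_density)
  then show "cdf_distribution law"
    unfolding cdf_distribution_def real_distribution_def real_distribution_axioms_def
    by (simp add: law_def)
qed

lemma sets_law [measurable_cong, simp]: "sets law = sets borel"
  by (simp add: law_def)

lemma support_convex: "convex (density_support p)"
  using p_log_concave by (simp add: log_concave_def concave_on_def convex_on_def)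

lemma U_open: "open U"
  by (simp add: U_def)

lemma U_convex: "convex U"
  using support_convex by (simp add: U_def convex_interior)

lemma U_between: "x \<in> U \<Longrightarrow> y \<in> U \<Longrightarrow> x \<le> z \<Longrightarrow> z \<le> y \<Longrightarrow> z \<in> U"
  using U_convex by (metis is_interval_convex_1 is_interval_1)

lemma p_pos: "x \<in> U \<Longrightarrow> 0 < p x"
  using interior_subset by (auto simp: U_def density_support_def)

lemma AE_law_U: "AE x in law. x \<in> U"
proof -
  have "frontier (density_support p) \<in> null_sets (completion lborel)"
    using negligible_convex_frontier[OF support_convex] by (simp add: negligible_iff_null_sets)
  then have "frontier (density_support p) \<in> null_sets lborel"
    by (subst (asm) null_sets_completion_iff) (auto simp: frontier_closed)
  then have "AE x in lborel. x \<notin> frontier (density_support p)"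
    by (rule AE_not_in)
  then have "AE x in lborel. 0 < ennreal (p x) \<longrightarrow> x \<in> U"
  proof eventually_elim
    case (elim x)
    then show ?case
      using closure_subset[of "density_support p"]
      by (auto simp: U_def frontier_def density_support_def)
  qed
  then show ?thesis
    unfolding law_def by (subst AE_density) auto
qed

lemma law_U: "measure law U = 1"
  using AE_law_U U_open by (subst law.prob_eq_1) auto

lemma law_singleton: "measure law {x} = 0"
proof -
  have "emeasure law {x} = (\<integral>\<^sup>+ y. ennreal (p y) * indicator {x} y \<partial>lborel)"
    by (simp add: law_def emeasure_density)
  also have "\<dots> = 0"
    by (intro nn_integral_null_set finite_imp_null_set_lborel) simp
  finally show ?thesis
    by (simp add: measure_def)
qed

lemma law_interval_pos:
  assumes "a < b" "{a<..<b} \<subseteq> U"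
  shows "0 < measure law {a<..<b}"
proof (rule ccontr)
  assume "\<not> ?thesis"
  then have "measure law {a<..<b} = 0"
    by (simp add: not_less measure_le_0_iff)
  then have "{a<..<b} \<in> null_sets law"
    by (auto simp: law.emeasure_eq_measure)
  then have "AE x in law. x \<notin> {a<..<b}"
    by (rule AE_not_in)
  then have "AE x in lborel. 0 < ennreal (p x) \<longrightarrow> x \<notin> {a<..<b}"
    unfolding law_def by (subst (asm) AE_density) auto
  from AE_lborel_exists_in_interval[OF this \<open>a < b\<close>] obtain x where x: "x \<in> {a<..<b}" "\<not> 0 < p x"
    by auto
  with assms(2) p_pos[of x] show False
    by blast
qed

abbreviation "F \<equiv> cdf law"

lemma F_cont: "isCont F x"
  by (simp add: law.isCont_cdf law_singleton)

lemma F_less: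
  assumes "x \<in> U" "y \<in> U" "x < y"
  shows "F x < F y"
proof -
  have "0 < measure law {x<..<y}"
    using assms(3) U_between[OF assms(1,2)] by (intro law_interval_pos) auto
  also have "\<dots> \<le> measure law {x<..y}"
    by (intro law.finite_measure_mono) auto
  also have "\<dots> = F y - F x"
    using assms by (simp add: law.cdf_diff_eq)
  finally show ?thesis
    by simp
qed

lemma F_in:
  assumes "x \<in> U"
  shows "F x \<in> {0<..<1}"
proof -
  obtain e where e: "e > 0" "cball x e \<subseteq> U"
    using assms U_open by (meson open_contains_cball)
  then have "x - e \<in> U" "x + e \<in> U"
    by (auto simp: subset_eq dist_real_def)
  then have "F (x - e) < F x" "F x < F (x + e)"
    using assms e by (auto intro!: F_less)
  then show ?thesis
    using law.cdf_nonneg[of "x - e"] law.cdf_bounded_prob[of "x + e"] by auto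
qed

lemma F_surj:
  assumes w: "w \<in> {0<..<1}"
  obtains x where "x \<in> U" "F x = w"
proof -
  have "\<forall>\<^sub>F x in at_bot. F x < w"
    using law.cdf_lim_at_bot w by (intro order_tendstoD) auto
  then obtain a where a: "\<And>x. x \<le> a \<Longrightarrow> F x < w"
    unfolding eventually_at_bot_linorder by blast
  have "\<forall>\<^sub>F x in at_top. w < F x"
    using law.cdf_lim_at_top_prob w by (intro order_tendstoD) auto
  then obtain b where b: "\<And>x. b \<le> x \<Longrightarrow> w < F x"
    unfolding eventually_at_top_linorder by blast
  have "\<exists>x. a \<le> x \<and> x \<le> max a b \<and> F x = w"
    using a[of a] b[of "max a b"] F_cont by (intro IVT) auto
  then obtain x where x: "F x = w"
    by blast
  have "x \<in> U"
  proof (rule ccontr)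
    assume "x \<notin> U"
    then consider "U \<subseteq> {..x}" | "U \<subseteq> {x<..}"
    proof (cases "\<exists>u\<in>U. x < u")
      case True
      then have "U \<subseteq> {x<..}"
        using U_between[of _ _ x] \<open>x \<notin> U\<close> by (metis greaterThan_iff less_imp_le not_less subsetI)
      then show ?thesis
        using that by blast
    next
      case False
      then have "U \<subseteq> {..x}"
        by force
      then show ?thesis
        using that by blast
    qed
    then show False
    proof cases
      case 1
      then have "measure law U \<le> F x"
        unfolding cdf_def by (intro law.finite_measure_mono) auto
      then show False
        using w x law_U by simp
    next
      case 2
      then have "measure law U \<le> measure law (space law - {..x})"
        by (intro law.finite_measure_mono) auto
      also have "\<dots> = 1 - F x"
        unfolding cdf_def by (subst law.prob_compl) auto
      finally show False
        using w x law_U by simp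
    qed
  qed
  with x show ?thesis
    by (intro that)
qed

text \<open>The value \<open>0\<close> outside the unit interval lets integrals over subsets of it be written as integrals
  of globally measurable functions.\<close>

definition Q :: "real \<Rightarrow> real"
  where "Q w = (if w \<in> {0<..<1} then law.I w else 0)"

lemma Q_F:
  assumes "x \<in> U"
  shows "Q (F x) = x"
proof -
  have le_iff: "F x \<le> F y \<longleftrightarrow> law.I (F x) \<le> y" for y
    using law.pseudoinverse[of "F x" y] F_in[OF assms] by auto
  have "\<not> law.I (F x) < x"
  proof
    assume less: "law.I (F x) < x"
    obtain e where e: "e > 0" "cball x e \<subseteq> U"
      using assms U_open by (meson open_contains_cball)
    define y where "y = max (law.I (F x)) (x - e)"
    have "x - e \<in> U"
      using e by (auto simp: subset_eq dist_real_def)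
    then have "y \<in> U" "y < x"
      using less e assms U_between[of "x - e" x y] by (auto simp: y_def)
    then have "F y < F x"
      using assms by (intro F_less)
    then show False
      using le_iff[of y] by (simp add: y_def)
  qed
  then show ?thesis
    using le_iff[of x] F_in[OF assms] by (simp add: Q_def)
qed

lemma
  assumes "w \<in> {0<..<1}"
  shows Q_in_U: "Q w \<in> U" and F_Q: "F (Q w) = w"
  using F_surj[OF assms] Q_F by metis+

lemma Q_less: "0 < v \<Longrightarrow> v < w \<Longrightarrow> w < 1 \<Longrightarrow> Q v < Q w"
  using F_less[of "Q w" "Q v"] Q_in_U[of v] Q_in_U[of w] F_Q[of v] F_Q[of w]
  by (cases "Q v" "Q w" rule: linorder_cases) auto

lemma Q_cont: "w \<in> {0<..<1} \<Longrightarrow> isCont Q w"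
proof -
  assume w: "w \<in> {0<..<1}"
  obtain e where e: "e > 0" "cball (Q w) e \<subseteq> U"
    using Q_in_U[OF w] U_open by (meson open_contains_cball)
  have "isCont Q (F (Q w))"
  proof (rule isCont_inverse_function[where d = e and x = "Q w" and f = F])
    show "Q (F z) = z" if "\<bar>z - Q w\<bar> \<le> e" for z
      using that e by (intro Q_F) (auto simp: subset_eq dist_real_def abs_minus_commute)
  qed (use e F_cont in auto)
  then show ?thesis
    using F_Q[OF w] by simp
qed

lemma Q_measurable [measurable]: "Q \<in> borel_measurable borel"
proof -
  have "Q = (\<lambda>w. indicator {0<..<1} w *\<^sub>R law.I w)"
    by (auto simp: Q_def fun_eq_iff)
  then show ?thesis
    using law.measurable_CI by (subst (asm) borel_measurable_restrict_space_iff) auto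
qed

lemma law_integral_eq:
  fixes f :: "real \<Rightarrow> real"
  assumes [measurable]: "f \<in> borel_measurable borel"
  shows "(\<integral>x. f x \<partial>law) = (\<integral>w. indicator {0<..<1} w * f (Q w) \<partial>lborel)"
proof -
  have "(\<integral>x. f x \<partial>law) = (\<integral>x. f x \<partial>distr (restrict_space lborel {0<..<1}) borel law.I)"
    by (simp add: law.distr_I_eq_M)
  also have "\<dots> = (\<integral>w. f (law.I w) \<partial>restrict_space lborel {0<..<1})"
  proof (rule integral_distr)
    have "sets (restrict_space lborel {0<..<1::real}) = sets (restrict_space borel {0<..<1})"
      by (intro sets_restrict_space_cong) simp
    from measurable_cong_sets[OF this refl] law.measurable_CI
    show "law.I \<in> restrict_space lborel {0<..<1} \<rightarrow>\<^sub>M borel"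
      by blast
  qed simp
  also have "\<dots> = (\<integral>w. indicator {0<..<1} w *\<^sub>R f (law.I w) \<partial>lborel)"
    by (subst integral_restrict_space) (auto simp: set_lebesgue_integral_def)
  also have "\<dots> = (\<integral>w. indicator {0<..<1} w * f (Q w) \<partial>lborel)"
    by (intro Bochner_Integration.integral_cong) (auto simp: Q_def split: split_indicator)
  finally show ?thesis .
qed

lemma measure_law_eq:
  assumes [measurable]: "T \<in> sets borel"
  shows "measure law T = measure lborel {w \<in> {0<..<1}. Q w \<in> T}"
proof -
  have "measure law T = (\<integral>x. indicator T x \<partial>law)"
    by simp
  also have "\<dots> = (\<integral>w. indicator {0<..<1} w * indicator T (Q w) \<partial>lborel)"
    by (subst law_integral_eq) auto
  also have "\<dots> = (\<integral>w. indicator {w \<in> {0<..<1}. Q w \<in> T} w \<partial>lborel)"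
    by (intro Bochner_Integration.integral_cong) (auto split: split_indicator)
  finally show ?thesis
    by simp
qed

lemma ln_p_convex: "convex_on U (\<lambda>x. - ln (p x))"
  using p_log_concave unfolding log_concave_def concave_on_def
  by (rule convex_on_subset) (auto simp: U_def interior_subset U_convex[unfolded U_def])

lemma p_cont: "continuous_on U p"
proof -
  have "continuous_on U (\<lambda>x. ln (p x))"
    using continuous_on_minus[OF convex_on_continuous[OF U_open ln_p_convex]] by simp
  then have "continuous_on U (\<lambda>x. exp (ln (p x)))"
    by (rule continuous_on_exp)
  then show ?thesis
    by (rule continuous_on_eq) (simp add: p_pos)
qed

lemma F_deriv:
  assumes "x \<in> U"
  shows "(F has_real_derivative p x) (at x)"
proof -
  obtain e where e: "e > 0" "cball x e \<subseteq> U"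
    using assms U_open by (meson open_contains_cball)
  then have sub: "{x - e..x + e} \<subseteq> U"
    by (simp add: cball_eq_atLeastAtMost)
  have F_eq: "F y = F (x - e) + integral {x - e..y} p" if y: "y \<in> {x - e..x + e}" for y
  proof (cases "y = x - e")
    case False
    then have "x - e < y"
      using y by simp
    have "p integrable_on {x - e..y}"
      using sub y by (intro integrable_continuous_real continuous_on_subset[OF p_cont]) auto
    moreover have "(\<integral>\<^sup>+ z. ennreal (p z) * indicator {x - e..y} z \<partial>lborel) = ennreal (integral {x - e..y} p)"
    proof -
      have "((\<lambda>z. if z \<in> {x - e..y} then p z else 0) has_integral integral {x - e..y} p) UNIV"
        using calculation by (subst has_integral_restrict_UNIV) (rule integrable_integral)
      then have "(\<integral>\<^sup>+ z. ennreal (if z \<in> {x - e..y} then p z else 0) \<partial>lborel) = ennreal (integral {x - e..y} p)"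
        by (intro nn_integral_has_integral_lborel) (auto simp: p_nonneg)
      also have "(\<lambda>z. ennreal (if z \<in> {x - e..y} then p z else 0)) = (\<lambda>z. ennreal (p z) * indicator {x - e..y} z)"
        by (auto simp: fun_eq_iff split: split_indicator)
      finally show ?thesis .
    qed
    moreover have "0 \<le> integral {x - e..y} p"
      using p_nonneg by (intro Henstock_Kurzweil_Integration.integral_nonneg calculation(1)) auto
    ultimately have "measure law {x - e..y} = integral {x - e..y} p"
      by (simp add: law_def measure_def emeasure_density)
    moreover have "measure law {x - e..y} = measure law {x - e} + measure law {x - e<..y}"
      using \<open>x - e < y\<close>
      by (subst law.finite_measure_Union[symmetric]) (auto intro!: arg_cong[where f = "measure law"])
    ultimately show ?thesis
      using law.cdf_diff_eq[OF \<open>x - e < y\<close>] by (simp add: law_singleton)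
  qed simp
  have "((\<lambda>y. integral {x - e..y} p) has_real_derivative p x) (at x within {x - e..x + e})"
    using e sub by (intro integral_has_real_derivative continuous_on_subset[OF p_cont]) auto
  then have "((\<lambda>y. F (x - e) + integral {x - e..y} p) has_real_derivative p x) (at x within {x - e..x + e})"
    by (auto intro!: derivative_eq_intros)
  then have "(F has_real_derivative p x) (at x within {x - e..x + e})"
    by (rule has_field_derivative_transform_within[OF _ e(1)]) (use e(1) in simp, rule F_eq[symmetric])
  then show ?thesis
    using e by (simp add: at_within_Icc_at)
qed


lemma Q_deriv:
  assumes w: "w \<in> {0<..<1}"
  shows "(Q has_real_derivative 1 / p (Q w)) (at w)"
proof -
  have "(Q has_real_derivative inverse (p (Q w))) (at w)"
    using F_deriv[OF Q_in_U[OF w]] p_pos[OF Q_in_U[OF w]] w F_Q Q_cont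
    by (intro DERIV_inverse_function[where f = F and a = 0 and b = 1]) auto
  then show ?thesis
    by (simp add: inverse_eq_divide)
qed

lemma p_tangent:
  assumes "x \<in> U"
  obtains k where "\<And>y. y \<in> U \<Longrightarrow> p y \<le> p x * exp (k * (y - x))"
proof -
  have "x \<in> interior U"
    using assms U_open by (simp add: interior_open)
  then obtain k where k: "\<And>y. y \<in> U \<Longrightarrow> - ln (p x) + k * (y - x) \<le> - ln (p y)"
    using convex_le_Inf_differential[OF ln_p_convex] by blast
  show ?thesis
  proof (rule that[of "- k"])
    fix y assume y: "y \<in> U"
    then have "exp (ln (p y)) \<le> exp (ln (p x) + - k * (y - x))"
      using k[of y] by simp
    then show "p y \<le> p x * exp (- k * (y - x))"
      using p_pos[OF y] p_pos[OF assms] by (simp add: exp_diff exp_minus divide_inverse)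
  qed
qed

lemma ln_p_chord:
  assumes "x \<in> U" "y \<in> U" "0 \<le> t" "t \<le> 1"
  shows "(1 - t) * ln (p x) + t * ln (p y) \<le> ln (p ((1 - t) * x + t * y))"
  using convex_onD[OF ln_p_convex assms(3,4,1,2)] by simp

text \<open>Log-concavity of \<^term>\<open>p\<close> means that \<open>p \<circ> Q\<close> is concave: its derivative at \<open>F x\<close> is
  \<open>p' x / p x = (ln p)' x\<close>. Since \<^term>\<open>p\<close> need not be differentiable, the slope of the
  tangent at \<open>F x\<close> is taken to be that of a tangent of \<open>ln p\<close> at \<^term>\<open>x\<close>.\<close>

lemma density_quantile_tangent:
  assumes z: "z \<in> {0<..<1}"
  obtains k where "\<And>w. w \<in> {0<..<1} \<Longrightarrow> p (Q w) \<le> p (Q z) + k * (w - z)"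
proof -
  define x where "x = Q z"
  have x: "x \<in> U" "F x = z"
    using z Q_in_U F_Q by (auto simp: x_def)
  obtain k where k: "\<And>y. y \<in> U \<Longrightarrow> p y \<le> p x * exp (k * (y - x))"
    using p_tangent[OF x(1)] by blast
  have linear: "(1 - r) * x + r * y = x + r * (y - x)" for r y
    by (simp add: algebra_simps)
  have "p y - p x \<le> k * (F y - F x)" if y: "y \<in> U" for y
  proof -
    consider "y = x" | "x < y" | "y < x"
      by linarith
    then show ?thesis
    proof cases
      case 2
      have in_U: "x + t \<in> U" if "0 \<le> t" "t \<le> y - x" for t
        using U_between[OF x(1) y] that by auto
      have "p (x + (y - x)) - p (x + 0) \<le> k * (F (x + (y - x)) - F (x + 0))"
      proof (rule log_concave_tangent_increment[where q = "\<lambda>t. p (x + t)" and G = "\<lambda>t. F (x + t)" and h = "y - x"])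
        fix t assume t: "0 \<le> t" "t \<le> y - x"
        show "((\<lambda>t. F (x + t)) has_real_derivative p (x + t)) (at t)"
          using F_deriv[OF in_U[OF t]] by (simp add: DERIV_shift add.commute)
        have "(1 - t / (y - x)) * x + t / (y - x) * y = x + t"
          unfolding linear using 2 by simp
        then show "(1 - t / (y - x)) * ln (p (x + 0)) + t / (y - x) * ln (p (x + (y - x))) \<le> ln (p (x + t))"
          using ln_p_chord[OF x(1) y, of "t / (y - x)"] t 2 by simp
        show "p (x + t) \<le> p (x + 0) * exp (k * t)"
          using k[OF in_U[OF t]] by simp
      qed (use 2 in_U p_pos in auto)
      then show ?thesis
        by simp
    next
      case 3
      have in_U: "x - t \<in> U" if "0 \<le> t" "t \<le> x - y" for t
        using U_between[OF y x(1)] that by auto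
      have "p (x - (x - y)) - p (x - 0) \<le> - k * (- F (x - (x - y)) - - F (x - 0))"
      proof (rule log_concave_tangent_increment[where q = "\<lambda>t. p (x - t)" and G = "\<lambda>t. - F (x - t)" and h = "x - y"])
        fix t assume t: "0 \<le> t" "t \<le> x - y"
        show "((\<lambda>t. - F (x - t)) has_real_derivative p (x - t)) (at t)"
          using F_deriv[OF in_U[OF t]] by (auto intro!: derivative_eq_intros DERIV_chain2[where f = F])
        have "(1 - t / (x - y)) * x + t / (x - y) * y = x - t"
          unfolding linear using 3 by (simp add: field_simps)
        then show "(1 - t / (x - y)) * ln (p (x - 0)) + t / (x - y) * ln (p (x - (x - y))) \<le> ln (p (x - t))"
          using ln_p_chord[OF x(1) y, of "t / (x - y)"] t 3 by simp
        show "p (x - t) \<le> p (x - 0) * exp (- k * t)"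
          using k[OF in_U[OF t]] by simp
      qed (use 3 in_U p_pos in auto)
      then show ?thesis
        by (simp add: algebra_simps)
    qed simp
  qed
  then have "p (Q w) - p (Q z) \<le> k * (w - z)" if "w \<in> {0<..<1}" for w
    using Q_in_U[OF that] F_Q[OF that] x by (metis x_def)
  then show ?thesis
    by (intro that[of k]) (auto simp: algebra_simps)
qed

lemma quantile_slope_convex: "convex_on {0<..<1} (\<lambda>w. 1 / p (Q w))"
proof (rule convex_onI)
  fix t x y :: real
  assume t: "0 < t" "t < 1" and x: "x \<in> {0<..<1}" and y: "y \<in> {0<..<1}"
  define z where "z = (1 - t) * x + t * y"
  have z: "z \<in> {0<..<1}"
    using convexD_alt[of "{0<..<1}" x y t] x y t by (simp add: z_def)
  obtain k where k: "\<And>w. w \<in> {0<..<1} \<Longrightarrow> p (Q w) \<le> p (Q z) + k * (w - z)"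
    using density_quantile_tangent[OF z] by blast
  have pos: "0 < p (Q x)" "0 < p (Q y)"
    using x y Q_in_U p_pos by blast+
  have "(1 - t) * p (Q x) + t * p (Q y) \<le> (1 - t) * (p (Q z) + k * (x - z)) + t * (p (Q z) + k * (y - z))"
    using k[OF x] k[OF y] t by (intro add_mono mult_left_mono) auto
  also have "\<dots> = p (Q z)"
    by (simp add: z_def algebra_simps)
  finally have "inverse (p (Q z)) \<le> inverse ((1 - t) * p (Q x) + t * p (Q y))"
    using pos t by (intro le_imp_inverse_le) (auto intro!: add_pos_pos)
  also have "\<dots> \<le> (1 - t) * inverse (p (Q x)) + t * inverse (p (Q y))"
    using convex_onD[OF convex_on_inverse[of "{0<..}"], of t "p (Q x)" "p (Q y)"] pos t by simp
  finally show "1 / p (Q ((1 - t) *\<^sub>R x + t *\<^sub>R y)) \<le> (1 - t) * (1 / p (Q x)) + t * (1 / p (Q y))"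
    by (simp add: z_def inverse_eq_divide)
qed simp

lemma quantile_increment_convex:
  assumes d: "0 < d" "d < 1"
  shows "convex_on {0<..<1 - d} (\<lambda>w. Q (w + d) - Q w)"
proof (rule convex_on_realI)
  fix x assume x: "x \<in> {0<..<1 - d}"
  have "(Q has_real_derivative 1 / p (Q (x + d))) (at (x + d))"
    using x d by (intro Q_deriv) auto
  then have "((\<lambda>w. Q (w + d)) has_real_derivative 1 / p (Q (x + d))) (at x)"
    by (simp add: DERIV_shift)
  then show "((\<lambda>w. Q (w + d) - Q w) has_real_derivative 1 / p (Q (x + d)) - 1 / p (Q x)) (at x)"
    using x d by (intro DERIV_diff Q_deriv) auto
next
  fix x y assume "x \<in> {0<..<1 - d}" "y \<in> {0<..<1 - d}" "x \<le> y"
  then show "1 / p (Q (x + d)) - 1 / p (Q x) \<le> 1 / p (Q (y + d)) - 1 / p (Q y)"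
    using convex_on_increment_mono[OF quantile_slope_convex, of x y d] d by auto
qed auto

text \<open>A positive concave function on the unit interval dominates a tent, so \<open>1 / (p \<circ> Q)\<close>
  grows at most like \<open>1 / w\<close> and \<open>1 / (1 - w)\<close> at the two ends. Hence the quantile function grows
  at most logarithmically there, which gives the finite second moment.\<close>

lemma quantile_slope_bound:
  obtains C where "0 < C" "\<And>w. w \<in> {0<..<1} \<Longrightarrow> 1 / p (Q w) \<le> C / w + C / (1 - w)"
proof
  define C where "C = 1 / p (Q (1 / 2))"
  have half: "0 < p (Q (1 / 2))"
    using Q_in_U[of "1 / 2"] p_pos by simp
  then show "0 < C"
    by (simp add: C_def)
  fix w :: real assume w: "w \<in> {0<..<1}"
  obtain k where k: "\<And>v. v \<in> {0<..<1} \<Longrightarrow> p (Q v) \<le> p (Q w) + k * (v - w)"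
    using density_quantile_tangent[OF w] by blast
  have pw: "0 < p (Q w)"
    using Q_in_U[OF w] p_pos by blast
  have tangent_pos: "0 \<le> p (Q w) + k * (v - w)" if "v \<in> {0<..<1}" for v
    using k[OF that] p_pos[OF Q_in_U[OF that]] by linarith
  have at_0: "k * w \<le> p (Q w)"
  proof (rule tendsto_upperbound)
    show "((\<lambda>v. k * (w - v)) \<longlongrightarrow> k * w) (at_right 0)"
      by (auto intro!: tendsto_eq_intros)
    have "\<forall>\<^sub>F v in at_right 0. v \<in> {0<..<1::real}"
      by (rule eventually_at_right_real) simp
    then show "\<forall>\<^sub>F v in at_right 0. k * (w - v) \<le> p (Q w)"
    proof eventually_elim
      case (elim v)
      then show ?case
        using tangent_pos[of v] by (simp add: algebra_simps)
    qed
  qed simp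
  have at_1: "- k * (1 - w) \<le> p (Q w)"
  proof (rule tendsto_upperbound)
    show "((\<lambda>v. - k * (v - w)) \<longlongrightarrow> - k * (1 - w)) (at_left 1)"
      by (auto intro!: tendsto_eq_intros)
    have "\<forall>\<^sub>F v in at_left 1. v \<in> {0<..<1::real}"
      by (rule eventually_at_left_real) simp
    then show "\<forall>\<^sub>F v in at_left 1. - k * (v - w) \<le> p (Q w)"
    proof eventually_elim
      case (elim v)
      then show ?case
        using tangent_pos[of v] by (simp add: algebra_simps)
    qed
  qed simp
  have at_half: "p (Q (1 / 2)) \<le> p (Q w) + k * (1 / 2 - w)"
    by (rule k) simp
  have "p (Q (1 / 2)) * (w * (1 - w)) \<le> p (Q w)"
  proof -
    have "p (Q (1 / 2)) * w \<le> p (Q w)" if "w \<le> 1 / 2"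
    proof -
      have "p (Q (1 / 2)) * w \<le> (p (Q w) + k * (1 / 2 - w)) * w"
        using at_half w by (intro mult_right_mono) auto
      also have "\<dots> = p (Q w) * w + (k * w) * (1 / 2 - w)"
        by (simp add: algebra_simps)
      also have "\<dots> \<le> p (Q w) * w + p (Q w) * (1 / 2 - w)"
        using at_0 that by (intro add_left_mono mult_right_mono) auto
      also have "\<dots> \<le> p (Q w)"
        using pw by (simp add: algebra_simps)
      finally show ?thesis .
    qed
    moreover have "p (Q (1 / 2)) * (1 - w) \<le> p (Q w)" if "1 / 2 \<le> w"
    proof -
      have "p (Q (1 / 2)) * (1 - w) \<le> (p (Q w) + k * (1 / 2 - w)) * (1 - w)"
        using at_half w by (intro mult_right_mono) auto
      also have "\<dots> = p (Q w) * (1 - w) + (- k * (1 - w)) * (w - 1 / 2)"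
        by (simp add: field_simps)
      also have "\<dots> \<le> p (Q w) * (1 - w) + p (Q w) * (w - 1 / 2)"
        using at_1 that by (intro add_left_mono mult_right_mono) auto
      also have "\<dots> \<le> p (Q w)"
        using pw by (simp add: algebra_simps)
      finally show ?thesis .
    qed
    moreover have "w * (1 - w) \<le> w" "w * (1 - w) \<le> 1 - w"
      using mult_left_le[of "1 - w" w] mult_left_le[of w "1 - w"] w by (auto simp: mult.commute)
    ultimately show ?thesis
      using half by (meson linear mult_left_mono less_imp_le order.trans)
  qed
  then have "1 / p (Q w) \<le> 1 / (p (Q (1 / 2)) * (w * (1 - w)))"
    using half w by (intro divide_left_mono) (auto intro!: mult_pos_pos pw)
  also have "\<dots> = C / w + C / (1 - w)"
    using half w by (simp add: C_def field_simps)
  finally show "1 / p (Q w) \<le> C / w + C / (1 - w)" .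
qed

lemma quantile_log_bound:
  obtains a C where "0 < C" "\<And>w. w \<in> {0<..<1} \<Longrightarrow> \<bar>Q w\<bar> \<le> a - C * ln w - C * ln (1 - w)"
proof -
  obtain C where C: "0 < C" "\<And>w. w \<in> {0<..<1} \<Longrightarrow> 1 / p (Q w) \<le> C / w + C / (1 - w)"
    using quantile_slope_bound by blast
  define H where "H w = C * ln w - C * ln (1 - w) - Q w" for w
  have H_mono: "H v \<le> H w" if "0 < v" "v \<le> w" "w < 1" for v w
  proof (rule DERIV_nonneg_imp_nondecreasing[OF \<open>v \<le> w\<close>])
    fix x assume "v \<le> x" "x \<le> w"
    then have x: "x \<in> {0<..<1}"
      using that by auto
    have "(H has_real_derivative C / x + C / (1 - x) - 1 / p (Q x)) (at x)"
      unfolding H_def using x by (auto intro!: derivative_eq_intros Q_deriv simp: field_simps)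
    then show "\<exists>y. (H has_real_derivative y) (at x) \<and> 0 \<le> y"
      using C(2)[OF x] by (intro exI[of _ "C / x + C / (1 - x) - 1 / p (Q x)"]) auto
  qed
  show ?thesis
  proof (rule that[OF C(1)])
    fix w :: real assume w: "w \<in> {0<..<1}"
    have ln: "C * ln w \<le> 0" "C * ln (1 - w) \<le> 0"
      using w C(1) by (auto simp: mult_le_0_iff)
    show "\<bar>Q w\<bar> \<le> \<bar>Q (1 / 2)\<bar> - C * ln w - C * ln (1 - w)"
    proof (cases "w \<le> 1 / 2")
      case True
      then have "Q w \<le> Q (1 / 2)"
        using Q_less[of w "1 / 2"] w by (cases "w = 1 / 2") (simp_all only: order_refl, auto)
      moreover have "H w \<le> H (1 / 2)"
        using True w by (intro H_mono) auto
      ultimately show ?thesis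
        using ln by (simp add: H_def)
    next
      case False
      then have "Q (1 / 2) \<le> Q w"
        using Q_less[of "1 / 2" w] w by auto
      moreover have "H (1 / 2) \<le> H w"
        using False w by (intro H_mono) auto
      ultimately show ?thesis
        using ln by (simp add: H_def)
    qed
  qed
qed

lemma quantile_square_integrable: "integrable lborel (\<lambda>w. (Q w)\<^sup>2)"
proof -
  obtain a C where C: "0 < C" "\<And>w. w \<in> {0<..<1} \<Longrightarrow> \<bar>Q w\<bar> \<le> a - C * ln w - C * ln (1 - w)"
    using quantile_log_bound by blast
  define g where "g w = 3 * a\<^sup>2 * indicator {0<..<1} w + 3 * C\<^sup>2 * (indicator {0<..<1} w * (ln w)\<^sup>2)
      + 3 * C\<^sup>2 * (indicator {0<..<1} (1 + - 1 * w) * (ln (1 + - 1 * w))\<^sup>2)" for w :: real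
  have g_int: "integrable lborel g"
    unfolding g_def
    by (intro Bochner_Integration.integrable_add integrable_mult_right ln_square_integrable
        lborel_integrable_real_affine[OF ln_square_integrable]) simp_all
  have bound: "AE w in lborel. norm ((Q w)\<^sup>2) \<le> norm (g w)"
  proof (intro AE_I2)
    fix w
    show "norm ((Q w)\<^sup>2) \<le> norm (g w)"
    proof (cases "w \<in> {0<..<1}")
      case True
      have sq3: "(x - y - z)\<^sup>2 \<le> 3 * x\<^sup>2 + 3 * y\<^sup>2 + 3 * z\<^sup>2" for x y z :: real
      proof -
        have "0 \<le> (x + y)\<^sup>2 + (x + z)\<^sup>2 + (y - z)\<^sup>2"
          by simp
        then show ?thesis
          by (simp add: power2_eq_square algebra_simps)
      qed
      have "(Q w)\<^sup>2 \<le> (a - C * ln w - C * ln (1 - w))\<^sup>2"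
        using C(2)[OF True] by (simp add: abs_le_square_iff[symmetric])
      also have "\<dots> \<le> g w"
        using sq3[of a "C * ln w" "C * ln (1 - w)"] True by (simp add: g_def power_mult_distrib)
      finally show ?thesis
        by (simp add: order.trans[OF _ abs_ge_self])
    next
      case False
      then have "Q w = 0"
        unfolding Q_def by (simp only: if_False)
      then show ?thesis
        by simp
    qed
  qed
  show ?thesis
    by (rule Bochner_Integration.integrable_bound[OF g_int _ bound]) measurable
qed

lemma convex_quantile:
  assumes "0 < \<eta>" "\<eta> < 1"
  shows "convex_quantile Q \<eta>"
proof
  show "continuous_on {0<..<1} Q"
    by (intro continuous_at_imp_continuous_on ballI Q_cont)
  show "Q w = 0" if "w \<notin> {0<..<1}" for w
    using that unfolding Q_def by (simp only: if_False)
qed (fact assms Q_measurable quantile_square_integrable | rule Q_less quantile_increment_convex; assumption)+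

end

section \<open>Silence sets and windows of the quantile function\<close>

locale log_concave_variable = log_concave_density p + prob_space M
  for p :: "real \<Rightarrow> real" and M :: "'a measure" +
  fixes X :: "'a \<Rightarrow> real"
  assumes X_measurable [measurable]: "X \<in> borel_measurable M"
    and distr_X: "distr M borel X = law"
begin

lemma sets_set_event [measurable]:
  assumes [measurable]: "T \<in> sets borel"
  shows "set_event M X T \<in> sets M"
  unfolding set_event_def by measurable

lemma measure_set_event: "T \<in> sets borel \<Longrightarrow> measure M (set_event M X T) = measure law T"
  unfolding distr_X[symmetric]
  by (subst measure_distr) (auto simp: set_event_def intro!: arg_cong[where f = "measure M"])

definition quantile_levels :: "real set \<Rightarrow> real set"
  where "quantile_levels T = {w \<in> {0<..<1}. Q w \<in> T}"

lemma sets_quantile_levels [measurable]: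
  assumes [measurable]: "T \<in> sets borel"
  shows "quantile_levels T \<in> sets borel"
  unfolding quantile_levels_def by measurable

lemma measure_quantile_levels: "T \<in> sets borel \<Longrightarrow> measure lborel (quantile_levels T) = measure law T"
  by (simp add: measure_law_eq quantile_levels_def)

text \<open>The law of \<^term>\<open>X\<close> is the image under \<^term>\<open>Q\<close> of the uniform measure on the unit interval, so
  conditional expectations given \<open>X \<in> T\<close> are averages over the levels that \<^term>\<open>Q\<close> maps into
  \<^term>\<open>T\<close>.\<close>

lemma cond_expectation_eq_mean_on:
  fixes f :: "real \<Rightarrow> real"
  assumes T [measurable]: "T \<in> sets borel" and pos: "0 < measure law T"
    and f [measurable]: "f \<in> borel_measurable borel"
  shows "cond_expectation M (set_event M X T) (\<lambda>\<omega>. f (X \<omega>)) = mean_on (quantile_levels T) (\<lambda>w. f (Q w))"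
proof -
  have "cond_expectation M (set_event M X T) (\<lambda>\<omega>. f (X \<omega>))
      = (\<integral>\<omega>. indicator (set_event M X T) \<omega> * f (X \<omega>) \<partial>M) / measure law T"
    unfolding cond_expectation_def using pos
    by (subst integral_uniform_measure) (auto simp: emeasure_eq_measure measure_set_event)
  also have "(\<integral>\<omega>. indicator (set_event M X T) \<omega> * f (X \<omega>) \<partial>M) = (\<integral>\<omega>. indicator T (X \<omega>) * f (X \<omega>) \<partial>M)"
    by (intro Bochner_Integration.integral_cong) (auto simp: set_event_def split: split_indicator)
  also have "\<dots> = (\<integral>x. indicator T x * f x \<partial>law)"
    unfolding distr_X[symmetric] by (subst integral_distr) auto
  also have "\<dots> = (\<integral>w. indicator {0<..<1} w * (indicator T (Q w) * f (Q w)) \<partial>lborel)"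
    by (rule law_integral_eq) measurable
  also have "\<dots> = (\<integral>w. indicator (quantile_levels T) w * f (Q w) \<partial>lborel)"
    by (intro Bochner_Integration.integral_cong) (auto simp: quantile_levels_def split: split_indicator)
  finally show ?thesis
    by (simp add: mean_on_def measure_quantile_levels)
qed

lemma cond_variance_eq_var_on:
  assumes T: "T \<in> sets borel" and pos: "0 < measure law T"
  shows "cond_variance M X T = var_on (quantile_levels T) Q"
  unfolding cond_variance_def var_on_def
  using cond_expectation_eq_mean_on[OF T pos, of "\<lambda>x. x"]
    cond_expectation_eq_mean_on[OF T pos, of "\<lambda>x. (x - c)\<^sup>2" for c]
  by simp

lemma U_nonempty: "U \<noteq> {}"
  using law_U by auto

lemma closure_U: "closure U = closure (density_support p)"
  using convex_closure_interior[OF support_convex] U_nonempty by (simp add: U_def)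

lemma interior_closure_support: "interior (closure (density_support p)) = U"
  using convex_interior_closure[OF support_convex] by (simp add: U_def)

lemma closed_interval_subset_U:
  assumes "is_interval T" "T \<subseteq> closure (density_support p)" "x \<in> T" "y \<in> T"
  shows "{x<..<y} \<subseteq> U"
proof -
  have "{x<..<y} \<subseteq> T"
    using assms(1,3,4) unfolding is_interval_1 by (meson greaterThanLessThan_iff less_imp_le subsetI)
  then have "{x<..<y} \<subseteq> interior (closure (density_support p))"
    using assms(2) by (intro interior_maximal) auto
  then show ?thesis
    by (simp add: interior_closure_support)
qed

end

locale silence_problem = log_concave_variable p M X
  for p and M :: "'a measure" and X +
  fixes \<eta> :: real
  assumes eta_bounds: "0 < \<eta>" "\<eta> < 1"
begin

sublocale convex_quantile Q \<eta>
  using convex_quantile[OF eta_bounds] .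

text \<open>At \<open>u = 0\<close> and \<open>u = 1 - \<eta>\<close> an end of the interval is an end of the support, possibly infinite, where
  \<^term>\<open>Q\<close> has no meaningful value; the closure produces the right interval in all cases.\<close>

definition interval_at :: "real \<Rightarrow> real set"
  where "interval_at u = closure (Q ` {u<..<u + \<eta>})"

context
  fixes u :: real
  assumes u: "u \<in> {0..1 - \<eta>}"
begin

lemma window_subset_levels: "{u<..<u + \<eta>} \<subseteq> quantile_levels (interval_at u)"
  using u closure_subset[of "Q ` {u<..<u + \<eta>}"] by (auto simp: quantile_levels_def interval_at_def)

lemma levels_subset_window: "quantile_levels (interval_at u) \<subseteq> {u..u + \<eta>}"
proof
  fix w assume "w \<in> quantile_levels (interval_at u)"
  then have w: "w \<in> {0<..<1}" "Q w \<in> closure (Q ` {u<..<u + \<eta>})"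
    by (auto simp: quantile_levels_def interval_at_def)
  have "u \<le> w"
  proof (rule ccontr)
    assume "\<not> u \<le> w"
    then have "Q ` {u<..<u + \<eta>} \<subseteq> {Q u..}"
      using w u by (auto simp: Q_le_iff)
    then have "closure (Q ` {u<..<u + \<eta>}) \<subseteq> {Q u..}"
      by (intro closure_minimal) auto
    then show False
      using w u \<open>\<not> u \<le> w\<close> eta Q_le_iff[of u w] by auto
  qed
  moreover have "w \<le> u + \<eta>"
  proof (rule ccontr)
    assume "\<not> w \<le> u + \<eta>"
    then have "Q ` {u<..<u + \<eta>} \<subseteq> {..Q (u + \<eta>)}"
      using w u eta by (auto simp: Q_le_iff)
    then have "closure (Q ` {u<..<u + \<eta>}) \<subseteq> {..Q (u + \<eta>)}"
      by (intro closure_minimal) auto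
    then show False
      using w u \<open>\<not> w \<le> u + \<eta>\<close> eta Q_le_iff[of w "u + \<eta>"] by auto
  qed
  ultimately show "w \<in> {u..u + \<eta>}"
    by simp
qed

lemma AE_levels_window: "AE w in lborel. w \<in> quantile_levels (interval_at u) \<longleftrightarrow> w \<in> {u<..<u + \<eta>}"
  using AE_lborel_singleton[of u] AE_lborel_singleton[of "u + \<eta>"]
proof eventually_elim
  case (elim w)
  then show ?case
    using window_subset_levels levels_subset_window
    by (metis atLeastAtMost_iff greaterThanLessThan_iff order_le_less subsetD)
qed

lemma interval_at_closed: "closed (interval_at u)"
  by (simp add: interval_at_def)

lemma interval_at_borel: "interval_at u \<in> sets borel"
  using interval_at_closed by auto

lemma interval_at_is_interval: "is_interval (interval_at u)"
proof -
  have "connected (Q ` {u<..<u + \<eta>})"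
    using u by (intro connected_continuous_image continuous_on_subset[OF Q_cont]) auto
  then show ?thesis
    by (simp add: interval_at_def is_interval_connected_1 connected_imp_connected_closure)
qed

lemma interval_at_nonempty: "interval_at u \<noteq> {}"
  using eta by (simp add: interval_at_def)

lemma interval_at_subset: "interval_at u \<subseteq> closure (density_support p)"
proof -
  have "Q ` {u<..<u + \<eta>} \<subseteq> U"
    using u Q_in_U by auto
  then show ?thesis
    unfolding interval_at_def closure_U[symmetric] by (rule closure_mono)
qed

lemma measure_interval_at: "measure law (interval_at u) = \<eta>"
proof -
  have "measure lborel (quantile_levels (interval_at u)) = measure lborel {u<..<u + \<eta>}"
    using AE_levels_window interval_at_borel sets_quantile_levels[OF interval_at_borel]
    by (intro measure_eq_AE) auto
  then show ?thesis
    using eta by (simp add: measure_quantile_levels interval_at_borel)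
qed

lemma cond_variance_interval_at: "cond_variance M X (interval_at u) = window_var u"
proof -
  have "mean_on (quantile_levels (interval_at u)) f = mean_on {u<..<u + \<eta>} f" if "f \<in> borel_measurable borel" for f
    using that AE_levels_window by (intro mean_on_AE_cong sets_quantile_levels interval_at_borel) auto
  then have "var_on (quantile_levels (interval_at u)) Q = window_var u"
    by (simp add: window_var_def var_on_def)
  then show ?thesis
    using cond_variance_eq_var_on[OF interval_at_borel] measure_interval_at eta by simp
qed

end

text \<open>The levels of an interval form an interval of length \<^term>\<open>\<eta>\<close>, that is, a window up to its ends.
  Inside the closed support, a nondegenerate closed interval is recovered from its interior,
  all of whose points are values of \<^term>\<open>Q\<close>.\<close>

lemma closed_interval_is_interval_at:
  assumes T: "closed T" "is_interval T" "T \<subseteq> closure (density_support p)" and mass: "measure law T = \<eta>"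
  obtains u where "u \<in> {0..1 - \<eta>}" "T = interval_at u"
proof -
  have T_borel: "T \<in> sets borel"
    using T by auto
  define A where "A = quantile_levels T"
  have A_mass: "measure lborel A = \<eta>"
    using mass by (simp add: A_def measure_quantile_levels T_borel)
  have A_unit: "A \<subseteq> {0<..<1}"
    by (auto simp: A_def quantile_levels_def)
  have A_nonempty: "A \<noteq> {}"
    using A_mass eta by auto
  have A_between: "w \<in> A" if "v \<in> A" "v' \<in> A" "v \<le> w" "w \<le> v'" for v v' w
  proof -
    have w: "w \<in> {0<..<1}" "v \<in> {0<..<1}" "v' \<in> {0<..<1}" "Q v \<in> T" "Q v' \<in> T"
      using that A_unit by (auto simp: A_def quantile_levels_def)
    then have "Q v \<le> Q w" "Q w \<le> Q v'"
      using that(3,4) by (simp_all only: Q_le_iff)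
    then have "Q w \<in> T"
      using w T(2) unfolding is_interval_1 by blast
    then show ?thesis
      using w by (simp add: A_def quantile_levels_def)
  qed
  have bdd: "bdd_below A" "bdd_above A"
    using A_unit by (auto intro!: bdd_belowI[of _ 0] bdd_aboveI[of _ 1])
  define u v where "u = Inf A" and "v = Sup A"
  have sup: "A \<subseteq> {u..v}"
    using bdd by (auto simp: u_def v_def intro: cInf_lower cSup_upper)
  have sub: "{u<..<v} \<subseteq> A"
  proof
    fix w assume "w \<in> {u<..<v}"
    then obtain x y where "x \<in> A" "x < w" "y \<in> A" "w < y"
      using A_nonempty bdd by (auto simp: u_def v_def cInf_less_iff less_cSup_iff)
    then show "w \<in> A"
      by (intro A_between[of x y w]) auto
  qed
  have "u \<le> v"
    using sup A_nonempty by auto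
  have "AE w in lborel. w \<in> A \<longleftrightarrow> w \<in> {u<..<v}"
    using AE_lborel_singleton[of u] AE_lborel_singleton[of v]
  proof eventually_elim
    case (elim w)
    then show ?case
      using sub sup by (metis atLeastAtMost_iff greaterThanLessThan_iff order_le_less subsetD)
  qed
  then have "measure lborel A = measure lborel {u<..<v}"
    using sets_quantile_levels[OF T_borel] by (intro measure_eq_AE) (auto simp: A_def)
  then have v: "v = u + \<eta>"
    using A_mass \<open>u \<le> v\<close> by simp
  have "0 \<le> u" "v \<le> 1"
    using A_nonempty A_unit by (auto simp: u_def v_def intro!: cInf_greatest cSup_least)
  then have u_range: "u \<in> {0..1 - \<eta>}"
    using v by simp
  have "T = closure (Q ` {u<..<v})"
  proof
    have "Q ` {u<..<v} \<subseteq> T"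
      using sub by (auto simp: A_def quantile_levels_def)
    then show "closure (Q ` {u<..<v}) \<subseteq> T"
      using T(1) by (rule closure_minimal)
    obtain x y where xy: "x \<in> Q ` {u<..<v}" "y \<in> Q ` {u<..<v}" "x < y"
    proof (rule that)
      show "Q (u + \<eta> / 3) < Q (u + \<eta> / 2)"
        using u_range eta by (intro Q_less) auto
    qed (use v eta in auto)
    then have "{x<..<y} \<subseteq> T"
      using \<open>Q ` {u<..<v} \<subseteq> T\<close> T(2) unfolding is_interval_1
      by (meson greaterThanLessThan_iff less_imp_le subsetD subsetI)
    then have "{x<..<y} \<subseteq> interior T"
      by (intro interior_maximal) auto
    then have "interior T \<noteq> {}"
      using xy(3) by auto
    then have "closure (interior T) = T"
      using convex_closure_interior[of T] T by (simp add: is_interval_convex_1)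
    moreover have "interior T \<subseteq> Q ` {u<..<v}"
    proof
      fix y assume y: "y \<in> interior T"
      have TU: "interior T \<subseteq> U"
        using interior_mono[OF T(3)] by (simp add: interior_closure_support)
      obtain e where e: "e > 0" "cball y e \<subseteq> interior T"
        using y by (meson open_contains_cball open_interior)
      then have "y - e \<in> interior T" "y + e \<in> interior T"
        by (auto simp: subset_eq dist_real_def)
      then have *: "y - e \<in> U" "y + e \<in> U" "y \<in> U" "y - e \<in> T" "y + e \<in> T"
        using TU y interior_subset by blast+
      then have "F (y - e) \<in> A" "F (y + e) \<in> A"
        unfolding A_def quantile_levels_def using F_in Q_F by simp_all
      moreover have "F (y - e) < F y" "F y < F (y + e)"
        using * e by (auto intro!: F_less)
      ultimately have "F y \<in> {u<..<v}"
        using sup by (auto simp: subset_eq)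
      then show "y \<in> Q ` {u<..<v}"
        using Q_F[OF \<open>y \<in> U\<close>] by (metis imageI)
    qed
    ultimately show "T \<subseteq> closure (Q ` {u<..<v})"
      using closure_mono by metis
  qed
  then show ?thesis
    using u_range by (intro that[of u]) (simp_all add: interval_at_def v)
qed

lemma optimal_interval_iff:
  "optimal_interval M X p \<eta> T \<longleftrightarrow>
    (\<exists>u. u \<in> {0..1 - \<eta>} \<and> (\<forall>v\<in>{0..1 - \<eta>}. window_var u \<le> window_var v) \<and> T = interval_at u)"
proof
  assume opt: "optimal_interval M X p \<eta> T"
  then have T: "closed T" "is_interval T" "T \<subseteq> closure (density_support p)"
    and mass: "measure M (set_event M X T) = \<eta>" and min: "minimizes_cond_variance M X \<eta> T"
    by (auto simp: optimal_interval_def)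
  have "measure law T = \<eta>"
    using mass T(1) by (simp add: measure_set_event)
  then obtain u where u: "u \<in> {0..1 - \<eta>}" "T = interval_at u"
    using closed_interval_is_interval_at T by metis
  moreover have "window_var u \<le> window_var v" if v: "v \<in> {0..1 - \<eta>}" for v
    using min u v interval_at_borel[OF v]
    by (auto simp: minimizes_cond_variance_def measure_set_event measure_interval_at cond_variance_interval_at
        dest!: bspec[of _ _ "interval_at v"])
  ultimately show "\<exists>u. u \<in> {0..1 - \<eta>} \<and> (\<forall>v\<in>{0..1 - \<eta>}. window_var u \<le> window_var v) \<and> T = interval_at u"
    by blast
next
  assume "\<exists>u. u \<in> {0..1 - \<eta>} \<and> (\<forall>v\<in>{0..1 - \<eta>}. window_var u \<le> window_var v) \<and> T = interval_at u"
  then obtain u where u: "u \<in> {0..1 - \<eta>}" and min: "\<And>v. v \<in> {0..1 - \<eta>} \<Longrightarrow> window_var u \<le> window_var v"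
    and T: "T = interval_at u"
    by blast
  have "cond_variance M X T \<le> cond_variance M X T'"
    if T': "T' \<in> sets borel" "\<eta> \<le> measure M (set_event M X T')" for T'
  proof -
    have mass: "\<eta> \<le> measure law T'"
      using T' by (simp add: measure_set_event)
    obtain v where "v \<in> {0..1 - \<eta>}" "window_var v \<le> var_on (quantile_levels T') Q"
    proof (rule window_var_le_var_on)
      show "quantile_levels T' \<in> sets borel" "quantile_levels T' \<subseteq> {0<..<1}" "\<eta> \<le> measure lborel (quantile_levels T')"
        using T' mass by (auto simp: measure_quantile_levels sets_quantile_levels) (auto simp: quantile_levels_def)
    qed
    then have "window_var u \<le> var_on (quantile_levels T') Q"
      using min by (meson order.trans)
    then show ?thesis
      using cond_variance_eq_var_on[OF T'(1)] mass eta u by (simp add: T cond_variance_interval_at)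
  qed
  then show "optimal_interval M X p \<eta> T"
    using u interval_at_borel[OF u]
    by (simp add: optimal_interval_def minimizes_cond_variance_def T interval_at_nonempty interval_at_closed
        interval_at_is_interval interval_at_subset measure_set_event measure_interval_at)
qed

text \<open>If there are several optimal windows, then they are translates of each other. The shift between
  two of them can be read off at the midpoint of the windows, and it depends continuously
  on the window, so the left ends fill an interval.\<close>

lemma optimal_intervals:
  obtains (single) S where "\<And>T. optimal_interval M X p \<eta> T \<longleftrightarrow> T = S" "\<exists>a l. 0 \<le> l \<and> S = {a..a + l}"
  | (family) l lo hi :: real where "0 < l" "lo < hi"
    "\<And>T. optimal_interval M X p \<eta> T \<longleftrightarrow> (\<exists>a. lo \<le> a \<and> a \<le> hi \<and> T = {a..a + l})"
proof -
  obtain u1 u2 where range: "0 \<le> u1" "u1 \<le> u2" "u2 \<le> 1 - \<eta>"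
    and minimal: "\<And>u. u \<in> {u1..u2} \<longleftrightarrow> u \<in> {0..1 - \<eta>} \<and> (\<forall>v\<in>{0..1 - \<eta>}. window_var u \<le> window_var v)"
    and translate: "\<And>u v. u \<in> {u1..u2} \<Longrightarrow> v \<in> {u1..u2} \<Longrightarrow> \<exists>k. \<forall>s\<in>{0<..<\<eta>}. Q (u + s) = Q (v + s) + k"
    by (fact minimizing_windows)
  have optimal: "optimal_interval M X p \<eta> T \<longleftrightarrow> (\<exists>u\<in>{u1..u2}. T = interval_at u)" for T
    unfolding optimal_interval_iff using minimal by blast
  have u1: "u1 \<in> {u1..u2}"
    using range by simp
  then have u1': "u1 \<in> {0..1 - \<eta>}" "\<And>v. v \<in> {0..1 - \<eta>} \<Longrightarrow> window_var u1 \<le> window_var v"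
    using minimal[of u1] by auto
  have "bounded (interval_at u1)"
    unfolding interval_at_def using minimizer_bounded[OF u1'] by (rule bounded_closure)
  then have "compact (interval_at u1)"
    using interval_at_closed[OF u1'(1)] by (simp add: compact_eq_bounded_closed)
  moreover have "connected (interval_at u1)"
    using interval_at_is_interval[OF u1'(1)] by (simp add: is_interval_connected_1)
  ultimately obtain a b where ab: "interval_at u1 = {a..b}"
    using connected_compact_interval_1 by metis
  have "a < b"
  proof -
    have "measure law {a..b} = \<eta>"
      using measure_interval_at[OF u1'(1)] by (simp add: ab)
    then have "\<not> {a..b} \<subseteq> {a}"
      using law.finite_measure_mono[of "{a..b}" "{a}"] law_singleton[of a] eta by auto
    then show ?thesis
      by auto
  qed
  define left_end where "left_end u = a + (Q (u + \<eta> / 2) - Q (u1 + \<eta> / 2))" for u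
  have interval: "interval_at u = {left_end u..left_end u + (b - a)}" if u: "u \<in> {u1..u2}" for u
  proof -
    obtain k where k: "\<And>s. s \<in> {0<..<\<eta>} \<Longrightarrow> Q (u + s) = Q (u1 + s) + k"
      using translate[OF u u1] by blast
    then have k_eq: "left_end u = k + a"
      using eta by (simp add: left_end_def)
    have shift: "{v<..<v + \<eta>} = (+) v ` {0<..<\<eta>}" for v
    proof (intro set_eqI iffI)
      fix x assume "x \<in> {v<..<v + \<eta>}"
      then show "x \<in> (+) v ` {0<..<\<eta>}"
        by (intro image_eqI[of _ _ "x - v"]) auto
    qed auto
    have "Q ` {u<..<u + \<eta>} = (+) k ` Q ` {u1<..<u1 + \<eta>}"
      unfolding shift image_image using k by (intro image_cong) auto
    then have "interval_at u = (+) k ` interval_at u1"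
      by (simp only: interval_at_def closure_translation)
    then show ?thesis
      by (simp add: ab k_eq)
  qed
  show ?thesis
  proof (cases "u1 = u2")
    case True
    then have "optimal_interval M X p \<eta> T \<longleftrightarrow> T = {a..b}" for T
      using optimal ab by simp
    then show ?thesis
      using \<open>a < b\<close> by (intro single[of "{a..b}"]) (auto intro!: exI[of _ a] exI[of _ "b - a"])
  next
    case False
    then have "u1 < u2"
      using range by simp
    have mono: "left_end u \<le> left_end v" if "u \<in> {u1..u2}" "v \<in> {u1..u2}" "u \<le> v" for u v
      using that range eta by (simp add: left_end_def Q_le_iff)
    have "continuous_on {u1..u2} left_end"
      unfolding left_end_def using range eta
      by (intro continuous_intros continuous_on_compose2[OF Q_cont]) auto
    then have surj: "\<exists>u\<in>{u1..u2}. left_end u = x" if "left_end u1 \<le> x" "x \<le> left_end u2" for x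
      using IVT'[of left_end u1 x u2] that range by auto
    have "optimal_interval M X p \<eta> T \<longleftrightarrow>
        (\<exists>x. left_end u1 \<le> x \<and> x \<le> left_end u2 \<and> T = {x..x + (b - a)})" for T
    proof
      assume "optimal_interval M X p \<eta> T"
      then obtain u where "u \<in> {u1..u2}" "T = interval_at u"
        using optimal by blast
      then show "\<exists>x. left_end u1 \<le> x \<and> x \<le> left_end u2 \<and> T = {x..x + (b - a)}"
        using interval mono[of u1 u] mono[of u u2] range by (intro exI[of _ "left_end u"]) auto
    next
      assume "\<exists>x. left_end u1 \<le> x \<and> x \<le> left_end u2 \<and> T = {x..x + (b - a)}"
      then obtain u where "u \<in> {u1..u2}" "T = {left_end u..left_end u + (b - a)}"
        using surj by blast
      then show "optimal_interval M X p \<eta> T"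
        unfolding optimal using interval by blast
    qed
    moreover have "left_end u1 < left_end u2"
      using \<open>u1 < u2\<close> range eta by (simp add: left_end_def Q_less_iff)
    ultimately show ?thesis
      using \<open>a < b\<close> by (intro family[of "b - a" "left_end u1" "left_end u2"]) auto
  qed
qed

end

section \<open>Mass zero and mass one\<close>

context log_concave_variable
begin

lemma cond_variance_nonneg: "0 \<le> cond_variance M X T"
  unfolding cond_variance_def cond_expectation_def by simp

text \<open>An interval of positive length inside the closed support has positive mass, so the optimal intervals
  for mass zero are the points.\<close>

lemma optimal_interval_0_iff:
  "optimal_interval M X p 0 T \<longleftrightarrow> (\<exists>a\<in>closure (density_support p). T = {a})"
proof
  assume "optimal_interval M X p 0 T"
  then have T: "T \<noteq> {}" "closed T" "is_interval T" "T \<subseteq> closure (density_support p)"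
    and mass: "measure M (set_event M X T) = 0"
    by (auto simp: optimal_interval_def)
  have "measure law T = 0"
    using mass T(2) by (simp add: measure_set_event)
  have "\<not> x < y" if xy: "x \<in> T" "y \<in> T" for x y
  proof
    assume "x < y"
    then have "0 < measure law {x<..<y}"
      using closed_interval_subset_U[OF T(3,4) xy] by (rule law_interval_pos)
    moreover have "{x<..<y} \<subseteq> T"
      using T(3) xy unfolding is_interval_1 by (meson greaterThanLessThan_iff less_imp_le subsetI)
    then have "measure law {x<..<y} \<le> measure law T"
      using T(2) by (intro law.finite_measure_mono) auto
    ultimately show False
      using \<open>measure law T = 0\<close> by simp
  qed
  then have eq: "x = y" if "x \<in> T" "y \<in> T" for x y
    using that by (meson linorder_neqE)
  obtain a where "a \<in> T"
    using T(1) by blast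
  then have "T = {a}"
    using eq by (intro set_eqI) auto
  then show "\<exists>a\<in>closure (density_support p). T = {a}"
    using T(4) by blast
next
  assume "\<exists>a\<in>closure (density_support p). T = {a}"
  then obtain a where a: "a \<in> closure (density_support p)" and T: "T = {a}"
    by blast
  have mass: "measure M (set_event M X T) = 0"
    by (simp add: T measure_set_event law_singleton)
  then have "set_event M X T \<in> null_sets M"
    using sets_set_event[of T] by (auto simp: T emeasure_eq_measure)
  then have "cond_variance M X T = 0"
    by (rule cond_variance_null)
  then show "optimal_interval M X p 0 T"
    using a mass cond_variance_nonneg by (auto simp: optimal_interval_def minimizes_cond_variance_def T is_interval_1)
qed

text \<open>All sets of mass one give the same conditional law, so they all have the same conditional
  variance. A closed set of mass one contains the interior of the support, on which no open
  interval is null.\<close>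

lemma optimal_interval_1_iff:
  "optimal_interval M X p 1 T \<longleftrightarrow> T = closure (density_support p)"
proof
  assume "optimal_interval M X p 1 T"
  then have T: "closed T" "T \<subseteq> closure (density_support p)"
    and mass: "measure M (set_event M X T) = 1"
    by (auto simp: optimal_interval_def)
  have "measure law T = 1"
    using mass T(1) by (simp add: measure_set_event)
  have "U \<subseteq> T"
  proof (rule ccontr)
    assume "\<not> U \<subseteq> T"
    then obtain x where "x \<in> U - T"
      by blast
    moreover have "open (U - T)"
      using U_open T(1) by (rule open_Diff)
    ultimately obtain e where e: "e > 0" "ball x e \<subseteq> U - T"
      by (meson open_contains_ball)
    have ball: "ball x e = {x - e<..<x + e}"
      by (rule ball_eq_greaterThanLessThan)
    have "0 < measure law {x - e<..<x + e}"
      using e ball by (intro law_interval_pos) auto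
    also have "\<dots> \<le> measure law (space law - T)"
      using e ball T(1) by (intro law.finite_measure_mono) auto
    also have "\<dots> = 0"
      using T(1) \<open>measure law T = 1\<close> by (subst law.prob_compl) auto
    finally show False
      by simp
  qed
  then have "closure U \<subseteq> T"
    using T(1) by (rule closure_minimal)
  then show "T = closure (density_support p)"
    using T(2) closure_U by auto
next
  assume T: "T = closure (density_support p)"
  have "law.prob U \<le> law.prob T"
    unfolding T closure_U[symmetric] by (intro law.finite_measure_mono closure_subset) auto
  then have "law.prob T = 1"
    unfolding law_U by (intro antisym law.prob_le_1)
  then have mass: "measure M (set_event M X T) = 1"
    by (simp add: measure_set_event T)
  have full: "cond_variance M X A = variance X"
    if A: "A \<in> sets borel" "1 \<le> measure M (set_event M X A)" for A
  proof -
    have E: "set_event M X A \<in> events" "prob (set_event M X A) = 1"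
      using A prob_le_1[of "set_event M X A"] by auto
    have "uniform_measure M (set_event M X A) = density M (\<lambda>_. 1)"
      unfolding uniform_measure_def
    proof (rule density_cong)
      have "AE \<omega> in M. \<omega> \<in> set_event M X A"
        using E by (simp add: prob_eq_1)
      then show "AE \<omega> in M. indicator (set_event M X A) \<omega> / emeasure M (set_event M X A) = (1 :: ennreal)"
        using E by (auto simp: emeasure_eq_measure elim!: eventually_mono)
    qed (use E in auto)
    then show ?thesis
      by (simp add: cond_variance_def cond_expectation_def density_1)
  qed
  have "is_interval T"
    unfolding T is_interval_convex_1 by (rule convex_closure[OF support_convex])
  moreover have "T \<noteq> {}"
    using U_nonempty closure_subset[of U] by (auto simp: T closure_U)
  ultimately show "optimal_interval M X p 1 T"
    using mass full[of T] full by (auto simp: optimal_interval_def minimizes_cond_variance_def T)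
qed

end

section \<open>Intervals with extended real bounds\<close>

text \<open>Bounds in the extended reals describe bounded and unbounded closed intervals uniformly.\<close>

lemma closed_convex_real_eq:
  fixes C :: "real set"
  assumes C: "closed C" "convex C" "C \<noteq> {}"
  shows "a \<in> C \<longleftrightarrow> Inf (ereal ` C) \<le> ereal a \<and> ereal a \<le> Sup (ereal ` C)"
proof
  assume "a \<in> C"
  then show "Inf (ereal ` C) \<le> ereal a \<and> ereal a \<le> Sup (ereal ` C)"
    by (auto intro: Inf_lower Sup_upper)
next
  assume a: "Inf (ereal ` C) \<le> ereal a \<and> ereal a \<le> Sup (ereal ` C)"
  show "a \<in> C"
  proof (rule ccontr)
    assume "a \<notin> C"
    have "is_interval C"
      using C(2) by (simp add: is_interval_convex_1)
    then consider "\<And>x. x \<in> C \<Longrightarrow> x < a" | "\<And>x. x \<in> C \<Longrightarrow> a < x"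
      using \<open>a \<notin> C\<close> unfolding is_interval_1 by (metis not_less)
    then show False
    proof cases
      case 1
      then have "bdd_above C"
        by (meson bdd_aboveI less_imp_le)
      then have "Sup C \<in> C" "Sup (ereal ` C) \<le> ereal (Sup C)"
        using C by (auto intro!: closed_contains_Sup Sup_least cSup_upper)
      then have "ereal a \<le> ereal (Sup C)"
        using a order.trans by blast
      then show False
        using 1[OF \<open>Sup C \<in> C\<close>] by simp
    next
      case 2
      then have "bdd_below C"
        by (meson bdd_belowI less_imp_le)
      then have "Inf C \<in> C" "ereal (Inf C) \<le> Inf (ereal ` C)"
        using C by (auto intro!: closed_contains_Inf Inf_greatest cInf_lower)
      then have "ereal (Inf C) \<le> ereal a"
        using a order.trans by blast
      then show False
        using 2[OF \<open>Inf C \<in> C\<close>] by simp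
    qed
  qed
qed

text \<open>The real points of a nondegenerate interval of extended reals accumulate at both of its ends, so
  they determine its bounds.\<close>

lemma ereal_bounds_le:
  fixes lo hi lo' hi' :: ereal
  assumes "lo < hi" and sub: "\<And>a :: real. lo \<le> ereal a \<Longrightarrow> ereal a \<le> hi \<Longrightarrow> lo' \<le> ereal a \<and> ereal a \<le> hi'"
  shows "lo' \<le> lo" "hi \<le> hi'"
proof -
  show "lo' \<le> lo"
  proof (rule ccontr)
    assume "\<not> lo' \<le> lo"
    then have "lo < min hi lo'"
      using assms(1) by simp
    then obtain a where "lo < ereal a" "ereal a < min hi lo'"
      using ereal_dense2 by blast
    then show False
      using sub[OF less_imp_le less_imp_le, of a] by auto
  qed
  show "hi \<le> hi'"
  proof (rule ccontr)
    assume "\<not> hi \<le> hi'"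
    then have "max lo hi' < hi"
      using assms(1) by simp
    then obtain a where "max lo hi' < ereal a" "ereal a < hi"
      using ereal_dense2 by blast
    then show False
      using sub[OF less_imp_le less_imp_le, of a] by auto
  qed
qed

text \<open>The family of all translates of one interval, with left end between two distinct bounds,
  determines its length and its bounds.\<close>

lemma sliding_family_unique:
  fixes lo hi :: ereal and l :: real
  assumes l: "0 \<le> l" and lohi: "lo < hi" and side: "C l lo hi"
    and family: "\<And>T. P T \<longleftrightarrow> (\<exists>a. lo \<le> ereal a \<and> ereal a \<le> hi \<and> T = {a..a + l})"
  shows "\<exists>!(l :: real, lo :: ereal, hi :: ereal). 0 \<le> l \<and> lo < hi \<and> C l lo hi \<and>
    (\<forall>T. P T \<longleftrightarrow> (\<exists>a. lo \<le> ereal a \<and> ereal a \<le> hi \<and> T = {a..a + l}))"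
proof (rule ex1I[of _ "(l, lo, hi)"])
  show "case (l, lo, hi) of (l, lo, hi) \<Rightarrow> 0 \<le> l \<and> lo < hi \<and> C l lo hi \<and>
    (\<forall>T. P T \<longleftrightarrow> (\<exists>a. lo \<le> ereal a \<and> ereal a \<le> hi \<and> T = {a..a + l}))"
    using assms by simp
next
  fix x :: "real \<times> ereal \<times> ereal"
  assume x: "case x of (l, lo, hi) \<Rightarrow> 0 \<le> l \<and> lo < hi \<and> C l lo hi \<and>
    (\<forall>T. P T \<longleftrightarrow> (\<exists>a. lo \<le> ereal a \<and> ereal a \<le> hi \<and> T = {a..a + l}))"
  obtain l' lo' hi' where x_eq: "x = (l', lo', hi')"
    by (cases x)
  have l': "0 \<le> l'" and lohi': "lo' < hi'"
    and family': "\<And>T. P T \<longleftrightarrow> (\<exists>a. lo' \<le> ereal a \<and> ereal a \<le> hi' \<and> T = {a..a + l'})"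
    using x by (auto simp: x_eq)
  obtain r where "lo < ereal r" "ereal r < hi"
    using ereal_dense2[OF lohi] by blast
  then have "P {r..r + l}"
    unfolding family by (intro exI[of _ r]) auto
  then obtain a where "{r..r + l} = {a..a + l'}"
    unfolding family' by blast
  then have ll: "l' = l"
    using l l' by (auto simp: Icc_eq_Icc)
  have member: "P {a..a + l} \<longleftrightarrow> lo \<le> ereal a \<and> ereal a \<le> hi" for a
    unfolding family using l by (auto simp: Icc_eq_Icc)
  have member': "P {a..a + l} \<longleftrightarrow> lo' \<le> ereal a \<and> ereal a \<le> hi'" for a
    unfolding family' ll using l by (auto simp: Icc_eq_Icc)
  have "lo' \<le> lo" "hi \<le> hi'"
    using member member' by (intro ereal_bounds_le[OF lohi]; blast)+
  moreover have "lo \<le> lo'" "hi' \<le> hi"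
    using member member' by (intro ereal_bounds_le[OF lohi']; blast)+
  ultimately show "x = (l, lo, hi)"
    by (simp add: x_eq ll)
qed

lemma unique_interval_parameters:
  fixes S :: "real set"
  assumes "\<exists>a l. 0 \<le> l \<and> S = {a..a + l}"
  shows "\<exists>!(a, l). 0 \<le> l \<and> S = {a..a + l}"
proof -
  obtain a l where "0 \<le> l" "S = {a..a + l}"
    using assms by blast
  then show ?thesis
    by (intro ex1I[of _ "(a, l)"]) (auto simp: Icc_eq_Icc)
qed

section \<open>Optimal silence intervals\<close>

theorem theorem1:
  fixes M :: "'a measure" and X :: "'a \<Rightarrow> real" and p :: "real \<Rightarrow> real" and \<eta> :: real
  assumes "prob_space M"
    and "\<And>x. 0 \<le> p x"
    and "distributed M lborel X (\<lambda>x. ennreal (p x))"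
    and "log_concave p"
    and "0 \<le> \<eta>" and "\<eta> \<le> 1"
  shows
    "(\<exists>S. (\<forall>T. optimal_interval M X p \<eta> T \<longleftrightarrow> T = S) \<and>
          (\<eta> < 1 \<or> bounded (density_support p) \<longrightarrow> (\<exists>!(a, l). 0 \<le> l \<and> S = {a..a + l})))
     \<or>
     (\<exists>!(l :: real, lo :: ereal, hi :: ereal).
        0 \<le> l \<and> lo < hi \<and>
        (0 < \<eta> \<longrightarrow> 0 < l \<and> \<bar>lo\<bar> \<noteq> \<infinity> \<and> \<bar>hi\<bar> \<noteq> \<infinity>) \<and>
        (\<forall>T. optimal_interval M X p \<eta> T \<longleftrightarrow>
             (\<exists>a. lo \<le> ereal a \<and> ereal a \<le> hi \<and> T = {a..a + l})))"
    (is "?single \<or> ?family")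
proof -
  interpret M: prob_space M
    by fact
  have X_lborel: "X \<in> M \<rightarrow>\<^sub>M lborel" and density: "distr M lborel X = density lborel (\<lambda>x. ennreal (p x))"
    and p_ennreal: "(\<lambda>x. ennreal (p x)) \<in> borel_measurable borel"
    using assms(3) by (auto simp: distributed_def)
  have "(\<lambda>x. enn2real (ennreal (p x))) \<in> borel_measurable borel"
    using p_ennreal by (rule borel_measurable_enn2real)
  then have p_meas: "p \<in> borel_measurable borel"
    using assms(2) by simp
  interpret log_concave_density p
  proof
    have "prob_space (density lborel (\<lambda>x. ennreal (p x)))"
      unfolding density[symmetric] using X_lborel by (rule M.prob_space_distr)
    then have "emeasure (density lborel (\<lambda>x. ennreal (p x))) UNIV = 1"
      using prob_space.emeasure_space_1 by fastforce
    then show "(\<integral>\<^sup>+ x. ennreal (p x) \<partial>lborel) = 1"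
      using p_meas by (simp add: emeasure_density)
  qed (fact assms(2) assms(4) p_meas)+
  interpret log_concave_variable p M X
  proof
    show "X \<in> borel_measurable M"
      using X_lborel by simp
    have "distr M borel X = distr M lborel X"
      by (rule distr_cong) auto
    then show "distr M borel X = law"
      by (simp add: density law_def)
  qed
  consider "\<eta> = 0" | "\<eta> = 1" | "0 < \<eta>" "\<eta> < 1"
    using assms(5,6) by linarith
  then show ?thesis
  proof cases
    case 1
    define C where "C = closure (density_support p)"
    have C: "closed C" "convex C" "C \<noteq> {}"
      using U_nonempty closure_subset[of U] by (auto simp: C_def closure_U support_convex convex_closure)
    obtain x y where "x \<in> C" "y \<in> C" "x < y"
    proof (rule that)
      have half: "1 / 3 \<in> {0<..<1::real}" "1 / 2 \<in> {0<..<1::real}"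
        by auto
      show "Q (1 / 3) \<in> C" "Q (1 / 2) \<in> C"
        using Q_in_U[OF half(1)] Q_in_U[OF half(2)] closure_subset[of U] by (auto simp: C_def closure_U)
      show "Q (1 / 3) < Q (1 / 2)"
        by (rule Q_less) auto
    qed
    then have "Inf (ereal ` C) \<le> ereal x" "ereal x < ereal y" "ereal y \<le> Sup (ereal ` C)"
      by (auto intro: Inf_lower Sup_upper)
    then have bounds: "Inf (ereal ` C) < Sup (ereal ` C)"
      by (meson le_less_trans less_le_trans)
    have iff: "optimal_interval M X p \<eta> T
        \<longleftrightarrow> (\<exists>a. Inf (ereal ` C) \<le> ereal a \<and> ereal a \<le> Sup (ereal ` C) \<and> T = {a..a + 0})" for T
      unfolding 1 optimal_interval_0_iff C_def[symmetric] Bex_def closed_convex_real_eq[OF C]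
      by (simp only: add_0_right atLeastAtMost_singleton conj_assoc)
    have ?family
      by (rule sliding_family_unique[where l = 0 and C = "\<lambda>l lo hi. 0 < \<eta> \<longrightarrow> 0 < l \<and> \<bar>lo\<bar> \<noteq> \<infinity> \<and> \<bar>hi\<bar> \<noteq> \<infinity>"])
        (fact order_refl, fact bounds, simp add: 1, fact iff)
    then show ?thesis ..
  next
    case 2
    define S where "S = closure (density_support p)"
    have "\<exists>a l. 0 \<le> l \<and> S = {a..a + l}" if "bounded (density_support p)"
    proof -
      have "compact S" "connected S"
        using that support_convex by (auto simp: S_def convex_closure convex_connected)
      then obtain a b where "S = {a..b}"
        using connected_compact_interval_1 by metis
      moreover have "S \<noteq> {}"
        using U_nonempty closure_subset[of U] by (auto simp: S_def closure_U)
      ultimately show ?thesis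
        by (intro exI[of _ a] exI[of _ "b - a"]) auto
    qed
    then have ?single
      using optimal_interval_1_iff unique_interval_parameters[of S]
      by (intro exI[of _ S]) (auto simp: 2 S_def)
    then show ?thesis ..
  next
    case 3
    interpret silence_problem p M X \<eta>
      by unfold_locales (use 3 in auto)
    show ?thesis
    proof (cases rule: optimal_intervals)
      case (single S)
      then have ?single
        using unique_interval_parameters[of S] by (intro exI[of _ S]) blast
      then show ?thesis ..
    next
      case (family l lo hi)
      have bounds: "ereal lo < ereal hi"
        using family(2) by simp
      have iff: "optimal_interval M X p \<eta> T
          \<longleftrightarrow> (\<exists>a. ereal lo \<le> ereal a \<and> ereal a \<le> ereal hi \<and> T = {a..a + l})" for T
        using family(3) by simp
      have ?family
        by (rule sliding_family_unique[where l = l and C = "\<lambda>l lo hi. 0 < \<eta> \<longrightarrow> 0 < l \<and> \<bar>lo\<bar> \<noteq> \<infinity> \<and> \<bar>hi\<bar> \<noteq> \<infinity>"])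
          (fact less_imp_le[OF family(1)], fact bounds, simp add: family(1), fact iff)
      then show ?thesis ..
    qed
  qed
qed

end
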